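(* Let $P$ be a c.n.u. contraction on a Hilbert space $\mathcal{H}$. Let $V$ on $\mathcal{K}$ be an isometric dilation of $P$ corresponding to an isometry $\Pi : \mathcal{H} \to \mathcal{K}$. Then there exists a unique isometry $\Phi \in \mathcal{B}(\mathcal{H}_P, \mathcal{K})$ such that $$\Pi = \Phi\, \Pi_{NF} \qquad\text{and}\qquad \Phi (M_z \oplus M_{e^{it}})^* = V^* \Phi.$$ Moreover, let $\mathcal{K} = H^2_{\mathcal{E}}(\mathbb{D}) \oplus \mathcal{K}_u$ and $V = M_z \oplus U$ be the Wold decomposition of $V$ for some unitary $U \in \mathcal{B}(\mathcal{K}_u)$. Then $$\Phi = (I_{H^2(\mathbb{D})} \otimes V_1) \oplus V_2$$ for some isometries $V_1 \in \mathcal{B}(\mathcal{D}_{P^*}, \mathcal{E})$ and $V_2 \in \mathcal{B}(\overline{\Delta_P L^2_{\mathcal{D}_P}(\mathbb{T})}, \mathcal{K}_u)$.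
   Context: All Hilbert spaces are complex and separable; $H^2_{\mathcal{E}}(\mathbb{D})$ is the $\mathcal{E}$-valued Hardy space, identified with $H^2(\mathbb{D})\otimes\mathcal{E}$. A contraction $P$ is completely non-unitary (c.n.u.) if there is no nonzero $P$-reducing subspace on which $P$ is unitary. Isometric dilation: an isometry $V$ on $\mathcal{K}$ is an isometric dilation of $P$, corresponding to an isometry $\Pi:\mathcal{H}\to\mathcal{K}$, if $\Pi P^*=V^*\Pi$; it is minimal if $\mathcal{K}=\overline{\mathrm{span}}\{V^m\Pi\mathcal{H}: m\in\mathbb{N}\}$ (with $0 \in \mathbb{N}$). Sz.-Nagy--Foias model. $D_P=(I-P^*P)^{1/2}$, $D_{P^*}=(I-PP^* )^{1/2}$, $\mathcal{D}_P=\overline{\mathrm{ran}\,D_P}$, $\mathcal{D}_{P^*}=\overline{\mathrm{ran}\,D_{P^*}}$. The characteristic function is $\Theta_P(z)=[-P+zD_{P^*}(I-zP^* )^{-1}D_P]|_{\mathcal{D}_P}$, $z\in\mathbb{D}$, and $\Delta_P(t)=[I_{\mathcal{D}_P}-\Theta_P(e^{it})^*\Theta_P(e^{it})]^{1/2}$ for a.e. $e^{it}\in\mathbb{T}$, acting by multiplication on $L^2_{\mathcal{D}_P}(\mathbb{T})$. Set $\mathcal{H}_P=H^2_{\mathcal{D}_{P^*}}(\mathbb{D})\oplus\overline{\Delta_PL^2_{\mathcal{D}_P}(\mathbb{T})}$, $\mathcal{S}_P=\{\Theta_Pf\oplus\Delta_Pf: f\in H^2_{\mathcal{D}_P}(\mathbb{D})\}\subseteq\mathcal{H}_P$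 and $\mathcal{Q}_P=\mathcal{H}_P\ominus\mathcal{S}_P$. On the second summand of $\mathcal{H}_P$, $M_{e^{it}}$ denotes the restriction of multiplication by $e^{it}$ to $\overline{\Delta_PL^2_{\mathcal{D}_P}(\mathbb{T})}$. $\Pi_{NF}:\mathcal{H}\to\mathcal{H}_P$ is the Sz.-Nagy--Foias minimal isometric dilation of the c.n.u. contraction $P$: an isometry with range $\mathcal{Q}_P$ satisfying $\Pi_{NF}P^*=(M_z\oplus M_{e^{it}})^*\Pi_{NF}$ and $\mathcal{H}_P=\overline{\mathrm{span}}\{(M_z\oplus M_{e^{it}})^m\Pi_{NF}\mathcal{H}: m\ge 0\}$. *)

theory Defs
  imports "HOL-Analysis.Analysis"
begin

text \<open>Complex Hilbert spaces: \<^term>\<open>cinner\<close> is linear in its first argument and its real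
  part is the inner product that determines the norm. Separability is imposed where needed by the
  additional class \<^class>\<open>second_countable_topology\<close>.\<close>

class chilbert = real_inner + banach +
  fixes scaleC :: "complex \<Rightarrow> 'a \<Rightarrow> 'a"  (infixr \<open>*\<^sub>C\<close> 75)
    and cinner :: "'a \<Rightarrow> 'a \<Rightarrow> complex"
  assumes scaleC_add_right: "c *\<^sub>C (x + y) = c *\<^sub>C x + c *\<^sub>C y"
    and scaleC_add_left: "(c + d) *\<^sub>C x = c *\<^sub>C x + d *\<^sub>C x"
    and scaleC_scaleC: "c *\<^sub>C d *\<^sub>C x = (c * d) *\<^sub>C x"
    and scaleR_scaleC: "r *\<^sub>R x = complex_of_real r *\<^sub>C x"
    and cinner_add_left: "cinner (x + y) z = cinner x z + cinner y z"
    and cinner_scaleC_left: "cinner (c *\<^sub>C x) y = c * cinner x y"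
    and cinner_commute: "cinner x y = cnj (cinner y x)"
    and Re_cinner: "Re (cinner x y) = inner x y"

lemma scaleC_one [simp]: "1 *\<^sub>C x = x" for x :: "'a::chilbert"
  by (metis of_real_1 scaleR_one scaleR_scaleC)

global_interpretation complex_vector: vector_space "scaleC :: complex \<Rightarrow> 'a \<Rightarrow> 'a::chilbert"
  defines csubspace = complex_vector.subspace
    and cspan = complex_vector.span
  by unfold_locales (simp_all add: scaleC_add_right scaleC_add_left scaleC_scaleC)

lemma cinner_add_right: "cinner x (y + z) = cinner x y + cinner x z"
  for x y z :: "'a::chilbert"
  by (metis cinner_add_left cinner_commute complex_cnj_add)

lemma cinner_scaleC_right: "cinner x (c *\<^sub>C y) = cnj c * cinner x y"
  for x y :: "'a::chilbert"
  by (metis cinner_commute cinner_scaleC_left complex_cnj_mult)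

lemma cinner_self: "cinner x x = complex_of_real ((norm x)\<^sup>2)"
  for x :: "'a::chilbert"
proof -
  have "Im (cinner x x) = 0"
    using arg_cong[OF cinner_commute[of x x], of Im] by simp
  then show ?thesis
    by (simp add: complex_eq_iff Re_cinner power2_norm_eq_inner)
qed

lemma norm_scaleC: "norm (c *\<^sub>C x) = cmod c * norm x"
  for x :: "'a::chilbert"
proof -
  have "cinner (c *\<^sub>C x) (c *\<^sub>C x) = complex_of_real ((cmod c)\<^sup>2 * (norm x)\<^sup>2)"
    by (simp only: cinner_scaleC_left cinner_scaleC_right cinner_self[of x])
       (simp add: complex_norm_square algebra_simps del: of_real_power)
  then have "(norm (c *\<^sub>C x))\<^sup>2 = (cmod c * norm x)\<^sup>2"
    by (simp only: cinner_self of_real_eq_iff power_mult_distrib)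
  then show ?thesis
    by (simp add: power2_eq_iff_nonneg)
qed

lemma Im_cinner: "Im (cinner x y) = inner x (\<i> *\<^sub>C y)"
  for x y :: "'a::chilbert"
  by (simp flip: Re_cinner add: cinner_scaleC_right)

lemma bounded_bilinear_scaleC: "bounded_bilinear (scaleC :: complex \<Rightarrow> 'a \<Rightarrow> 'a::chilbert)"
proof
  show "\<exists>K. \<forall>a (b::'a). norm (a *\<^sub>C b) \<le> norm a * norm b * K"
    by (rule exI[of _ 1]) (simp add: norm_scaleC)
qed (simp_all add: scaleC_add_right scaleC_add_left scaleR_scaleC scaleC_scaleC
       scaleR_conv_of_real mult.commute)

lemma norm_cinner_le: "cmod (cinner x y) \<le> norm x * norm y"
  for x y :: "'a::chilbert"
proof (cases "cinner x y = 0")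
  case False
  define u where "u = cnj (sgn (cinner x y))"
  have u: "cmod u = 1" using False by (simp add: u_def norm_sgn)
  have "u * cinner x y = complex_of_real (cmod (cinner x y))"
    using False complex_norm_square[of "cinner x y"]
    by (simp add: u_def sgn_eq field_simps power2_eq_square)
  then have "cmod (cinner x y) = Re (cinner (u *\<^sub>C x) y)"
    by (simp add: cinner_scaleC_left)
  also have "\<dots> = inner (u *\<^sub>C x) y" by (simp add: Re_cinner)
  also have "\<dots> \<le> norm (u *\<^sub>C x) * norm y" by (rule norm_cauchy_schwarz)
  finally show ?thesis by (simp add: norm_scaleC u)
qed simp

lemma bounded_linear_cinner_left: "bounded_linear (\<lambda>x. cinner x y)"
  for y :: "'a::chilbert"
proof
  show "\<exists>K. \<forall>x. norm (cinner x y) \<le> norm x * K"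
    using norm_cinner_le by blast
qed (simp_all add: cinner_add_left scaleR_scaleC cinner_scaleC_left scaleR_conv_of_real)

instantiation complex :: chilbert
begin
definition "scaleC_complex c (z::complex) = c * z"
definition "cinner_complex z (w::complex) = z * cnj w"
instance
  by intro_classes
     (simp_all add: scaleC_complex_def cinner_complex_def algebra_simps scaleR_conv_of_real
        inner_complex_def)
end

instantiation prod :: (chilbert, chilbert) chilbert
begin
definition "scaleC_prod c (p::'a \<times> 'b) = (c *\<^sub>C fst p, c *\<^sub>C snd p)"
definition "cinner_prod (p::'a \<times> 'b) q = cinner (fst p) (fst q) + cinner (snd p) (snd q)"
instance
proof
  fix x y :: "'a \<times> 'b"
  show "cinner x y = cnj (cinner y x)"
    by (simp add: cinner_prod_def cinner_commute[of "fst x"] cinner_commute[of "snd x"])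
qed (simp_all add: scaleC_prod_def cinner_prod_def scaleC_add_right scaleC_add_left
        scaleC_scaleC scaleR_scaleC cinner_add_left cinner_scaleC_left distrib_left
        Re_cinner inner_prod_def prod_eq_iff)
end

definition square_summable :: "(nat \<Rightarrow> 'a::real_normed_vector) \<Rightarrow> bool" where
  "square_summable a \<longleftrightarrow> summable (\<lambda>n. (norm (a n))\<^sup>2)"

definition disc_series :: "(nat \<Rightarrow> 'a::chilbert) \<Rightarrow> complex \<Rightarrow> 'a" where
  "disc_series a z = (if cmod z < 1 then (\<Sum>n. z ^ n *\<^sub>C a n) else 0)"

text \<open>Elements of the vector-valued Hardy space are functions on the open unit disc;
  they are extended by zero so that equality of elements is equality of functions.\<close>

typedef (overloaded) ('a::chilbert) h2 =
  "{disc_series a | a :: nat \<Rightarrow> 'a. square_summable a}"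
  morphisms h2_fun Abs_h2
proof -
  have "disc_series (\<lambda>_. 0) \<in> {disc_series a | a :: nat \<Rightarrow> 'a. square_summable a}"
    by (auto simp: square_summable_def)
  then show ?thesis by blast
qed

definition h2_coeff :: "'a::chilbert h2 \<Rightarrow> nat \<Rightarrow> 'a" where
  "h2_coeff f = (THE a. square_summable a \<and> h2_fun f = disc_series a)"

lemma square_summable_zero [simp]: "square_summable (\<lambda>_. 0)"
  by (simp add: square_summable_def)

lemma square_summable_add:
  assumes "square_summable a" "square_summable b"
  shows "square_summable (\<lambda>n. a n + b n :: 'a::real_inner)"
  unfolding square_summable_def
proof (rule summable_comparison_test')
  show "summable (\<lambda>n. 2 * (norm (a n))\<^sup>2 + 2 * (norm (b n))\<^sup>2)"
    using assms by (intro summable_add summable_mult) (auto simp: square_summable_def)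
  fix n
  have "(norm (a n + b n))\<^sup>2 + (norm (a n - b n))\<^sup>2 = 2 * (norm (a n))\<^sup>2 + 2 * (norm (b n))\<^sup>2"
    by (simp add: power2_norm_eq_inner inner_simps inner_commute)
  then show "norm ((norm (a n + b n))\<^sup>2) \<le> 2 * (norm (a n))\<^sup>2 + 2 * (norm (b n))\<^sup>2"
    using zero_le_power2[of "norm (a n - b n)"]
    unfolding real_norm_def abs_power2 by linarith
qed

lemma square_summable_scaleC:
  "square_summable a \<Longrightarrow> square_summable (\<lambda>n. c *\<^sub>C (a n :: 'a::chilbert))"
  by (auto simp: square_summable_def norm_scaleC power_mult_distrib intro: summable_mult)

lemma square_summable_inner:
  fixes a b :: "nat \<Rightarrow> 'a::chilbert"
  assumes "square_summable a" "square_summable b"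
  shows "summable (\<lambda>n. inner (a n) (b n))" and "summable (\<lambda>n. cinner (a n) (b n))"
proof -
  have s: "summable (\<lambda>n. (norm (a n))\<^sup>2 + (norm (b n))\<^sup>2)"
    using assms by (intro summable_add) (auto simp: square_summable_def)
  have le: "norm (a n) * norm (b n) \<le> (norm (a n))\<^sup>2 + (norm (b n))\<^sup>2" for n
    using sum_squares_bound[of "norm (a n)" "norm (b n)"]
      mult_nonneg_nonneg[OF norm_ge_zero[of "a n"] norm_ge_zero[of "b n"]] by linarith
  show "summable (\<lambda>n. inner (a n) (b n))"
    by (rule summable_comparison_test'[OF s])
       (simp add: order_trans[OF Cauchy_Schwarz_ineq2 le])
  show "summable (\<lambda>n. cinner (a n) (b n))"
    by (rule summable_comparison_test'[OF s])
       (simp add: order_trans[OF norm_cinner_le le])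
qed

lemma summable_disc_series:
  fixes a :: "nat \<Rightarrow> 'a::chilbert"
  assumes "square_summable a" "cmod z < 1"
  shows "summable (\<lambda>n. z ^ n *\<^sub>C a n)"
proof (rule summable_comparison_test')
  show "summable (\<lambda>n. ((cmod z)\<^sup>2) ^ n + (norm (a n))\<^sup>2)"
    using assms by (intro summable_add summable_geometric)
      (auto simp: square_summable_def power_less_one_iff)
  fix n
  have le_sq: "x * y \<le> x\<^sup>2 + y\<^sup>2" if "0 \<le> x" "0 \<le> y" for x y :: real
    using sum_squares_bound[of x y] mult_nonneg_nonneg[OF that] by linarith
  show "norm (z ^ n *\<^sub>C a n) \<le> ((cmod z)\<^sup>2) ^ n + (norm (a n))\<^sup>2"
    using le_sq[of "cmod z ^ n" "norm (a n)"]
    by (simp add: norm_scaleC norm_power power_mult[symmetric] mult.commute)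
qed

lemma disc_series_inject:
  fixes a b :: "nat \<Rightarrow> 'a::chilbert"
  assumes "square_summable a" "square_summable b" "disc_series a = disc_series b"
  shows "a = b"
proof
  fix n
  have *: "(\<lambda>n. cinner (c n) y * z ^ n) sums cinner (disc_series c z) y"
    if "square_summable c" "cmod z < 1" for c :: "nat \<Rightarrow> 'a" and y z
  proof -
    have "(\<lambda>n. z ^ n *\<^sub>C c n) sums disc_series c z"
      using summable_disc_series[OF that] that by (simp add: disc_series_def summable_sums)
    from bounded_linear.sums[OF bounded_linear_cinner_left this, of y]
    show ?thesis by (simp add: cinner_scaleC_left mult.commute)
  qed
  have rad: "0 < fps_conv_radius (Abs_fps (\<lambda>n. cinner (c n) y))"
    if "square_summable c" for c :: "nat \<Rightarrow> 'a" and y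
  proof -
    have "ereal (norm (1/2 :: complex)) \<le> conv_radius (\<lambda>n. cinner (c n) y)"
      by (rule conv_radius_geI, rule sums_summable, rule *[OF that]) simp
    moreover have "0 < ereal (norm (1/2 :: complex))" by simp
    ultimately show ?thesis by (simp add: fps_conv_radius_def add: zero_ereal_def) (metis ereal_less(2) order_less_le_trans half_gt_zero_iff zero_less_one zero_ereal_def)
  qed
  have "Abs_fps (\<lambda>n. cinner (a n) y) = Abs_fps (\<lambda>n. cinner (b n) y)" for y
  proof (rule eval_fps_eqD[OF rad[OF assms(1)] rad[OF assms(2)]])
    have "eventually (\<lambda>z::complex. z \<in> ball 0 1) (nhds 0)"
      by (intro eventually_nhds_in_open) auto
    then show "\<forall>\<^sub>F z in nhds 0. eval_fps (Abs_fps (\<lambda>n. cinner (a n) y)) z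
        = eval_fps (Abs_fps (\<lambda>n. cinner (b n) y)) z"
    proof eventually_elim
      case (elim z)
      then have "cmod z < 1" by simp
      then show ?case
        using *[OF assms(1), of z y] *[OF assms(2), of z y] assms(3)
        by (simp add: eval_fps_def sums_unique[symmetric])
    qed
  qed
  then have "cinner (a n) y = cinner (b n) y" for y
    by (simp add: fps_eq_iff)
  then have "inner (a n - b n) y = 0" for y
    by (metis Re_cinner inner_diff_left eq_iff_diff_eq_0)
  then show "a n = b n"
    by (metis inner_eq_zero_iff eq_iff_diff_eq_0)
qed

lemma h2_coeff_works: "square_summable (h2_coeff f) \<and> h2_fun f = disc_series (h2_coeff f)"
proof -
  obtain a where a: "square_summable a" "h2_fun f = disc_series a"
    using h2_fun[of f] by auto
  show ?thesis
    unfolding h2_coeff_def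
    by (rule theI[of _ a]) (use a in \<open>auto intro: disc_series_inject\<close>)
qed

lemmas square_summable_coeff [simp] = h2_coeff_works[THEN conjunct1]
lemmas h2_fun_coeff = h2_coeff_works[THEN conjunct2]

lemma h2_fun_sums: "cmod z < 1 \<Longrightarrow> (\<lambda>n. z ^ n *\<^sub>C h2_coeff f n) sums h2_fun f z"
  unfolding h2_fun_coeff
  using summable_disc_series[of "h2_coeff f" z] by (simp add: disc_series_def summable_sums)

lemma h2_coeff_Abs [simp]: "square_summable a \<Longrightarrow> h2_coeff (Abs_h2 (disc_series a)) = a"
proof -
  assume a: "square_summable a"
  then have "h2_fun (Abs_h2 (disc_series a)) = disc_series a"
    by (auto intro!: Abs_h2_inverse)
  with a show ?thesis
    by (metis disc_series_inject h2_coeff_works)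
qed

lemma h2_eq_iff: "f = g \<longleftrightarrow> h2_coeff f = h2_coeff g"
  by (metis h2_fun_coeff h2_fun_inject)

lemma disc_series_linear:
  assumes "square_summable a" "square_summable b"
  shows "disc_series (\<lambda>n. c *\<^sub>C a n + d *\<^sub>C b n) = (\<lambda>z. c *\<^sub>C disc_series a z + d *\<^sub>C disc_series b z)"
proof
  fix z
  show "disc_series (\<lambda>n. c *\<^sub>C a n + d *\<^sub>C b n) z = c *\<^sub>C disc_series a z + d *\<^sub>C disc_series b z"
  proof (cases "cmod z < 1")
    case True
    have bl: "bounded_linear (\<lambda>x::'a. e *\<^sub>C x)" for e
      by (rule bounded_bilinear.bounded_linear_right[OF bounded_bilinear_scaleC])
    have "(\<lambda>n. c *\<^sub>C z ^ n *\<^sub>C a n + d *\<^sub>C z ^ n *\<^sub>C b n)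
        sums (c *\<^sub>C disc_series a z + d *\<^sub>C disc_series b z)"
      using True assms
      by (intro sums_add bounded_linear.sums[OF bl])
         (auto simp: disc_series_def intro!: summable_sums summable_disc_series)
    then have "(\<lambda>n. z ^ n *\<^sub>C (c *\<^sub>C a n + d *\<^sub>C b n))
        sums (c *\<^sub>C disc_series a z + d *\<^sub>C disc_series b z)"
      by (simp add: scaleC_add_right scaleC_scaleC mult.commute)
    then show ?thesis using True by (simp add: disc_series_def sums_unique[symmetric])
  next
    case False
    then show ?thesis by (simp add: disc_series_def)
  qed
qed

lemma h2_coeff_linear:
  fixes f g :: "'a::chilbert h2"
  shows "h2_coeff (Abs_h2 (\<lambda>z. c *\<^sub>C h2_fun f z + d *\<^sub>C h2_fun g z))
    = (\<lambda>n. c *\<^sub>C h2_coeff f n + d *\<^sub>C h2_coeff g n)"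
proof -
  have "Abs_h2 (\<lambda>z. c *\<^sub>C h2_fun f z + d *\<^sub>C h2_fun g z)
      = Abs_h2 (disc_series (\<lambda>n. c *\<^sub>C h2_coeff f n + d *\<^sub>C h2_coeff g n))"
    by (simp add: disc_series_linear h2_fun_coeff[symmetric])
  then show ?thesis
    by (simp add: square_summable_add square_summable_scaleC)
qed

lemma scaleC_minus_one: "(- 1) *\<^sub>C x = - x" for x :: "'b::chilbert"
  by (metis of_real_1 of_real_minus scaleR_minus1_left scaleR_scaleC)

instantiation h2 :: (chilbert) real_inner
begin

definition "0 = Abs_h2 (\<lambda>_. 0 :: 'a)"
definition "f + g = Abs_h2 (\<lambda>z. h2_fun f z + h2_fun g z)" for f g :: "'a h2"
definition "- f = Abs_h2 (\<lambda>z. - h2_fun f z)" for f :: "'a h2"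
definition "f - g = Abs_h2 (\<lambda>z. h2_fun f z - h2_fun g z)" for f g :: "'a h2"
definition "r *\<^sub>R f = Abs_h2 (\<lambda>z. r *\<^sub>R h2_fun f z)" for f :: "'a h2"
definition "inner f g = (\<Sum>n. inner (h2_coeff f n) (h2_coeff g n))" for f g :: "'a h2"
definition "norm f = sqrt (inner f f)" for f :: "'a h2"
definition "sgn f = inverse (norm f) *\<^sub>R f" for f :: "'a h2"
definition "dist f g = norm (f - g)" for f g :: "'a h2"
definition [code del]: "(uniformity :: ('a h2 \<times> 'a h2) filter)
    = (INF e\<in>{0<..}. principal {(x, y). dist x y < e})"
definition [code del]: "open (U :: 'a h2 set)
    \<longleftrightarrow> (\<forall>x\<in>U. \<forall>\<^sub>F (x', y) in uniformity. x' = x \<longrightarrow> y \<in> U)"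

lemma h2_coeff_zero: "h2_coeff (0 :: 'a h2) = (\<lambda>_. 0)"
proof -
  have "(\<lambda>_. 0 :: 'a) = disc_series (\<lambda>_. 0)"
    by (auto simp: disc_series_def)
  then show ?thesis by (simp add: zero_h2_def)
qed

lemma h2_coeff_ops:
  "h2_coeff (f + g) n = h2_coeff f n + h2_coeff g n"
  "h2_coeff (f - g) n = h2_coeff f n - h2_coeff g n"
  "h2_coeff (- f) n = - h2_coeff f n"
  "h2_coeff (r *\<^sub>R f) n = r *\<^sub>R h2_coeff f n" for f g :: "'a h2"
  using h2_coeff_linear[of 1 f 1 g] h2_coeff_linear[of 1 f "-1" g]
    h2_coeff_linear[of "-1" f 0 f] h2_coeff_linear[of "of_real r" f 0 f]
  by (simp_all add: plus_h2_def minus_h2_def uminus_h2_def scaleR_h2_def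
      scaleC_minus_one scaleR_scaleC)

instance
proof
  fix f g h :: "'a h2" and r s :: real
  note si = square_summable_inner[OF square_summable_coeff square_summable_coeff]
  show "dist f g = norm (f - g)" "sgn f = inverse (norm f) *\<^sub>R f"
    "norm f = sqrt (inner f f)"
    "(uniformity :: ('a h2 \<times> 'a h2) filter) = (INF e\<in>{0<..}. principal {(x, y). dist x y < e})"
    "open U \<longleftrightarrow> (\<forall>x\<in>U. \<forall>\<^sub>F (x', y) in uniformity. x' = x \<longrightarrow> y \<in> U)" for U :: "'a h2 set"
    by (simp_all add: dist_h2_def sgn_h2_def norm_h2_def uniformity_h2_def open_h2_def)
  show "inner f g = inner g f"
    by (simp add: inner_h2_def inner_commute)
  show "inner (f + g) h = inner f h + inner g h"
    by (simp add: inner_h2_def h2_coeff_ops inner_add_left suminf_add si)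
  show "inner (r *\<^sub>R f) g = r * inner f g"
    by (simp add: inner_h2_def h2_coeff_ops suminf_mult si)
  show "0 \<le> inner f f"
    by (simp add: inner_h2_def suminf_nonneg si)
  show "inner f f = 0 \<longleftrightarrow> f = 0"
    using suminf_eq_zero_iff[OF si(1)[of f f]]
    by (auto simp: inner_h2_def h2_eq_iff h2_coeff_zero fun_eq_iff)
qed (simp_all add: h2_eq_iff fun_eq_iff h2_coeff_ops h2_coeff_zero algebra_simps)

end

lemma h2_norm_sums:
  fixes f :: "'a::chilbert h2"
  shows "(\<lambda>n. (norm (h2_coeff f n))\<^sup>2) sums (norm f)\<^sup>2"
proof -
  have "summable (\<lambda>n. inner (h2_coeff f n) (h2_coeff f n))"
    by (simp add: square_summable_inner)
  then show ?thesis
    by (simp add: power2_norm_eq_inner inner_h2_def summable_sums)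
qed

lemma h2_sum_le:
  "finite A \<Longrightarrow> (\<Sum>k\<in>A. (norm (h2_coeff f k))\<^sup>2) \<le> (norm f)\<^sup>2"
  using sum_le_suminf[of "\<lambda>k. (norm (h2_coeff f k))\<^sup>2" A] h2_norm_sums[of f]
  by (simp add: sums_iff)

instance h2 :: (chilbert) banach
proof
  fix X :: "nat \<Rightarrow> 'a h2"
  assume X: "Cauchy X"
  have coeff_le: "norm (h2_coeff f n) \<le> norm f" for f :: "'a h2" and n
  proof -
    have "(norm (h2_coeff f n))\<^sup>2 \<le> (norm f)\<^sup>2"
      using h2_sum_le[of "{n}" f] by simp
    then show ?thesis by (rule power2_le_imp_le) simp
  qed
  have "Cauchy (\<lambda>k. h2_coeff (X k) n)" for n
    unfolding Cauchy_def
  proof (intro allI impI)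
    fix e :: real assume "0 < e"
    with X obtain M where "\<forall>m\<ge>M. \<forall>k\<ge>M. dist (X m) (X k) < e"
      unfolding Cauchy_def by blast
    moreover have "dist (h2_coeff (X m) n) (h2_coeff (X k) n) \<le> dist (X m) (X k)" for m k
      using coeff_le[of "X m - X k" n] by (simp add: dist_norm h2_coeff_ops)
    ultimately show "\<exists>M. \<forall>m\<ge>M. \<forall>k\<ge>M. dist (h2_coeff (X m) n) (h2_coeff (X k) n) < e"
      by (meson le_less_trans)
  qed
  then have "\<exists>l. (\<lambda>k. h2_coeff (X k) n) \<longlonglongrightarrow> l" for n
    by (simp add: Cauchy_convergent_iff convergent_def)
  then obtain a where a: "\<And>n. (\<lambda>k. h2_coeff (X k) n) \<longlonglongrightarrow> a n"
    by metis
  have bound: "(\<Sum>n<N. (norm (h2_coeff (X k) n - a n))\<^sup>2) \<le> e\<^sup>2"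
    if M: "\<forall>m\<ge>M. \<forall>k\<ge>M. dist (X m) (X k) < e" and k: "k \<ge> M" and "0 < e" for M k e N
  proof (rule tendsto_upperbound)
    show "(\<lambda>m. \<Sum>n<N. (norm (h2_coeff (X k) n - h2_coeff (X m) n))\<^sup>2)
        \<longlonglongrightarrow> (\<Sum>n<N. (norm (h2_coeff (X k) n - a n))\<^sup>2)"
      by (intro tendsto_intros a)
    show "\<forall>\<^sub>F m in sequentially. (\<Sum>n<N. (norm (h2_coeff (X k) n - h2_coeff (X m) n))\<^sup>2) \<le> e\<^sup>2"
      using eventually_ge_at_top[of M]
    proof eventually_elim
      case (elim m)
      have "(\<Sum>n<N. (norm (h2_coeff (X k - X m) n))\<^sup>2) \<le> (norm (X k - X m))\<^sup>2"
        by (rule h2_sum_le) simp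
      also have "\<dots> \<le> e\<^sup>2"
        using M k elim by (intro power_mono) (auto simp: dist_norm less_imp_le)
      finally show ?case by (simp add: h2_coeff_ops)
    qed
  qed simp
  have ssq: "square_summable (\<lambda>n. h2_coeff (X k) n - a n)"
    if "\<forall>m\<ge>M. \<forall>k\<ge>M. dist (X m) (X k) < e" "k \<ge> M" "0 < e" for M k e
    unfolding square_summable_def
  proof (rule bounded_imp_summable)
    show "(\<Sum>n\<le>N. (norm (h2_coeff (X k) n - a n))\<^sup>2) \<le> e\<^sup>2" for N
      using bound[OF that, of "Suc N"] by (simp only: lessThan_Suc_atMost)
  qed simp
  obtain M1 where M1: "\<forall>m\<ge>M1. \<forall>k\<ge>M1. dist (X m) (X k) < 1"
    using X unfolding Cauchy_def by (meson zero_less_one)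
  have "square_summable (\<lambda>n. h2_coeff (X M1) n + (-1) *\<^sub>C (h2_coeff (X M1) n - a n))"
    by (intro square_summable_add square_summable_scaleC ssq[OF M1]) auto
  then have sa: "square_summable a"
    by (simp add: scaleC_minus_one)
  define L where "L = Abs_h2 (disc_series a)"
  have L: "h2_coeff L = a" using sa by (simp add: L_def)
  have "X \<longlonglongrightarrow> L"
    unfolding LIMSEQ_def
  proof (intro allI impI)
    fix e :: real assume e: "0 < e"
    then obtain M where M: "\<forall>m\<ge>M. \<forall>k\<ge>M. dist (X m) (X k) < e / 2"
      using X unfolding Cauchy_def by (meson half_gt_zero)
    have "dist (X k) L < e" if "k \<ge> M" for k
    proof -
      have "(\<Sum>n<N. (norm (h2_coeff (X k - L) n))\<^sup>2) \<le> (e / 2)\<^sup>2" for N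
        using bound[OF M that, of N] e by (simp add: h2_coeff_ops L)
      then have "(norm (X k - L))\<^sup>2 \<le> (e / 2)\<^sup>2"
        using h2_norm_sums[of "X k - L"] by (metis sums_iff suminf_le_const)
      then have "norm (X k - L) \<le> e / 2"
        by (rule power2_le_imp_le) (use e in simp)
      then show ?thesis using e by (simp add: dist_norm)
    qed
    then show "\<exists>M. \<forall>k\<ge>M. dist (X k) L < e" by blast
  qed
  then show "convergent X" by (auto simp: convergent_def)
qed

instantiation h2 :: (chilbert) chilbert
begin

definition "c *\<^sub>C f = Abs_h2 (\<lambda>z. c *\<^sub>C h2_fun f z)" for f :: "'a h2"
definition "cinner f g = (\<Sum>n. cinner (h2_coeff f n) (h2_coeff g n))" for f g :: "'a h2"

lemma h2_coeff_scaleC: "h2_coeff (c *\<^sub>C f) n = c *\<^sub>C h2_coeff f n" for f :: "'a h2"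
  using h2_coeff_linear[of c f 0 f] by (simp add: scaleC_h2_def)

instance
proof
  fix f g h :: "'a h2" and c d :: complex and r :: real
  note si = square_summable_inner[OF square_summable_coeff square_summable_coeff]
  show "cinner (f + g) h = cinner f h + cinner g h"
    by (simp add: cinner_h2_def h2_coeff_ops cinner_add_left suminf_add si)
  show "cinner (c *\<^sub>C f) g = c * cinner f g"
    by (simp add: cinner_h2_def h2_coeff_scaleC cinner_scaleC_left suminf_mult si)
  have "(\<lambda>n. cnj (cinner (h2_coeff g n) (h2_coeff f n))) sums cnj (cinner g f)"
    unfolding sums_cnj cinner_h2_def by (rule summable_sums[OF si(2)])
  then have "(\<lambda>n. cinner (h2_coeff f n) (h2_coeff g n)) sums cnj (cinner g f)"
    by (simp flip: cinner_commute)
  then show "cinner f g = cnj (cinner g f)"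
    by (simp add: cinner_h2_def[of f g] sums_unique[symmetric])
  show "Re (cinner f g) = inner f g"
    by (simp add: cinner_h2_def inner_h2_def Re_suminf si Re_cinner)
qed (simp_all add: h2_eq_iff fun_eq_iff h2_coeff_ops h2_coeff_scaleC
       scaleC_add_right scaleC_add_left scaleC_scaleC scaleR_scaleC)

end
text \<open>Normalized arc length on the unit circle, as a measure on the complex plane.\<close>

definition circle_measure :: "complex measure" where
  "circle_measure = distr (uniform_measure lborel {0..2 * pi}) borel cis"

lemma sets_circle_measure [simp, measurable_cong]: "sets circle_measure = sets borel"
  and space_circle_measure [simp]: "space circle_measure = UNIV"
  by (simp_all add: circle_measure_def)

lemma cis_measurable [measurable]: "cis \<in> borel_measurable borel"
  by (rule borel_measurable_continuous_onI) (rule continuous_on_cis[OF continuous_on_id])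

lemma emeasure_circle_measure [simp]: "emeasure circle_measure UNIV = 1"
  unfolding circle_measure_def
  by (subst emeasure_distr)
     (simp_all add: emeasure_uniform_measure ennreal_divide_self
        ennreal_eq_0_iff not_le pi_gt_zero)

interpretation circle_measure: finite_measure circle_measure
  by standard simp

lemma measure_circle_measure [simp]: "measure circle_measure UNIV = 1"
  by (simp add: measure_def)

lemma AE_circle_measure: "AE \<zeta> in circle_measure. cmod \<zeta> = 1"
  unfolding circle_measure_def by (subst AE_distr_iff) auto

definition square_integrable :: "(complex \<Rightarrow> 'a::{chilbert, second_countable_topology}) \<Rightarrow> bool" where
  "square_integrable f \<longleftrightarrow> f \<in> borel_measurable circle_measure \<and>
     integrable circle_measure (\<lambda>\<zeta>. (norm (f \<zeta>))\<^sup>2)"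

lemma square_integrable_measurable [measurable_dest]:
  "square_integrable f \<Longrightarrow> f \<in> borel_measurable circle_measure"
  by (simp add: square_integrable_def)

quotient_type (overloaded) 'a l2 =
  "complex \<Rightarrow> 'a::{chilbert, second_countable_topology}" / partial: "\<lambda>f g. square_integrable f \<and> square_integrable g \<and>
     (AE \<zeta> in circle_measure. f \<zeta> = g \<zeta>)"
proof (rule part_equivpI)
  show "\<exists>f::complex \<Rightarrow> 'a. square_integrable f \<and> square_integrable f \<and>
      (AE \<zeta> in circle_measure. f \<zeta> = f \<zeta>)"
    by (rule exI[of _ "\<lambda>_. 0"]) (simp add: square_integrable_def)
  show "symp (\<lambda>f g::complex \<Rightarrow> 'a. square_integrable f \<and> square_integrable g \<and>
      (AE \<zeta> in circle_measure. f \<zeta> = g \<zeta>))"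
    by (auto simp: symp_def eq_commute)
  show "transp (\<lambda>f g::complex \<Rightarrow> 'a. square_integrable f \<and> square_integrable g \<and>
      (AE \<zeta> in circle_measure. f \<zeta> = g \<zeta>))"
    unfolding transp_def
  proof (intro allI impI conjI; (elim conjE)?)
    fix f g h :: "complex \<Rightarrow> 'a"
    assume "AE \<zeta> in circle_measure. f \<zeta> = g \<zeta>" "AE \<zeta> in circle_measure. g \<zeta> = h \<zeta>"
    then show "AE \<zeta> in circle_measure. f \<zeta> = h \<zeta>" by eventually_elim simp
  qed auto
qed

lemma borel_measurable_scaleC [measurable]:
  fixes f :: "'b \<Rightarrow> 'a::{chilbert, second_countable_topology}"
  assumes "c \<in> borel_measurable M" "f \<in> borel_measurable M"
  shows "(\<lambda>x. c x *\<^sub>C f x) \<in> borel_measurable M"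
  by (rule borel_measurable_continuous_Pair[OF assms])
     (intro bounded_bilinear.continuous_on[OF bounded_bilinear_scaleC] continuous_intros)

lemma borel_measurable_cinner [measurable]:
  fixes f g :: "'b \<Rightarrow> 'a::{chilbert, second_countable_topology}"
  assumes [measurable]: "f \<in> borel_measurable M" "g \<in> borel_measurable M"
  shows "(\<lambda>x. cinner (f x) (g x)) \<in> borel_measurable M"
  unfolding borel_measurable_complex_iff Re_cinner Im_cinner by measurable

lemma square_integrable_bound:
  fixes h :: "complex \<Rightarrow> 'b::{banach, second_countable_topology}"
  assumes "square_integrable f" "square_integrable g" "h \<in> borel_measurable circle_measure"
    and "AE \<zeta> in circle_measure. norm (h \<zeta>) \<le> C * (norm (f \<zeta>))\<^sup>2 + C * (norm (g \<zeta>))\<^sup>2"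
  shows "integrable circle_measure h"
proof (rule Bochner_Integration.integrable_bound)
  show "integrable circle_measure (\<lambda>\<zeta>. C * (norm (f \<zeta>))\<^sup>2 + C * (norm (g \<zeta>))\<^sup>2)"
    using assms by (auto simp: square_integrable_def)
  show "AE \<zeta> in circle_measure. norm (h \<zeta>) \<le> norm (C * (norm (f \<zeta>))\<^sup>2 + C * (norm (g \<zeta>))\<^sup>2)"
    using assms(4) by eventually_elim simp
qed (fact assms(3))

lemma square_integrable_zero [simp]: "square_integrable (\<lambda>_. 0)"
  by (simp add: square_integrable_def)

lemma square_integrable_add:
  assumes "square_integrable f" "square_integrable g"
  shows "square_integrable (\<lambda>\<zeta>. f \<zeta> + g \<zeta>)"
  unfolding square_integrable_def
proof
  note [measurable] = assms[THEN square_integrable_measurable]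
  show "(\<lambda>\<zeta>. f \<zeta> + g \<zeta>) \<in> borel_measurable circle_measure" by measurable
  have "norm ((norm (f \<zeta> + g \<zeta>))\<^sup>2) \<le> 2 * (norm (f \<zeta>))\<^sup>2 + 2 * (norm (g \<zeta>))\<^sup>2" for \<zeta>
  proof -
    have "(norm (f \<zeta> + g \<zeta>))\<^sup>2 + (norm (f \<zeta> - g \<zeta>))\<^sup>2 = 2 * (norm (f \<zeta>))\<^sup>2 + 2 * (norm (g \<zeta>))\<^sup>2"
      by (simp add: power2_norm_eq_inner inner_simps inner_commute)
    then show ?thesis
      using zero_le_power2[of "norm (f \<zeta> - g \<zeta>)"]
      unfolding real_norm_def abs_power2 by linarith
  qed
  then show "integrable circle_measure (\<lambda>\<zeta>. (norm (f \<zeta> + g \<zeta>))\<^sup>2)"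
    by (intro square_integrable_bound[OF assms, where C = 2]) auto
qed

lemma square_integrable_scaleC:
  assumes "square_integrable f" "c \<in> borel_measurable borel"
    and "AE \<zeta> in circle_measure. cmod (c \<zeta>) \<le> C"
  shows "square_integrable (\<lambda>\<zeta>. c \<zeta> *\<^sub>C f \<zeta>)"
  unfolding square_integrable_def
proof
  note [measurable] = assms(1)[THEN square_integrable_measurable] assms(2)
  show "(\<lambda>\<zeta>. c \<zeta> *\<^sub>C f \<zeta>) \<in> borel_measurable circle_measure" by measurable
  have "AE \<zeta> in circle_measure. norm ((norm (c \<zeta> *\<^sub>C f \<zeta>))\<^sup>2)
      \<le> C\<^sup>2 * (norm (f \<zeta>))\<^sup>2 + C\<^sup>2 * (norm (0::complex))\<^sup>2"
    using assms(3)
    by eventually_elim (auto simp: norm_scaleC power_mult_distrib intro!: mult_right_mono power_mono)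
  then show "integrable circle_measure (\<lambda>\<zeta>. (norm (c \<zeta> *\<^sub>C f \<zeta>))\<^sup>2)"
    by (intro square_integrable_bound[OF assms(1) square_integrable_zero]) auto
qed

lemma square_integrable_uminus: "square_integrable f \<Longrightarrow> square_integrable (\<lambda>\<zeta>. - f \<zeta>)"
  by (simp add: square_integrable_def)

lemma square_integrable_diff:
  "square_integrable f \<Longrightarrow> square_integrable g \<Longrightarrow> square_integrable (\<lambda>\<zeta>. f \<zeta> - g \<zeta>)"
  using square_integrable_add[of f "\<lambda>\<zeta>. - g \<zeta>"] square_integrable_uminus[of g] by simp

lemma square_integrable_cinner:
  assumes "square_integrable f" "square_integrable g"
  shows "integrable circle_measure (\<lambda>\<zeta>. inner (f \<zeta>) (g \<zeta>))"
    and "integrable circle_measure (\<lambda>\<zeta>. cinner (f \<zeta>) (g \<zeta>))"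
proof -
  note [measurable] = assms[THEN square_integrable_measurable]
  have le: "norm (f \<zeta>) * norm (g \<zeta>) \<le> 1 * (norm (f \<zeta>))\<^sup>2 + 1 * (norm (g \<zeta>))\<^sup>2" for \<zeta>
    using sum_squares_bound[of "norm (f \<zeta>)" "norm (g \<zeta>)"]
      mult_nonneg_nonneg[OF norm_ge_zero[of "f \<zeta>"] norm_ge_zero[of "g \<zeta>"]] by linarith
  show "integrable circle_measure (\<lambda>\<zeta>. inner (f \<zeta>) (g \<zeta>))"
    by (rule square_integrable_bound[OF assms, where C = 1])
       (use order_trans[OF Cauchy_Schwarz_ineq2 le] in auto)
  show "integrable circle_measure (\<lambda>\<zeta>. cinner (f \<zeta>) (g \<zeta>))"
    by (rule square_integrable_bound[OF assms, where C = 1])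
       (use order_trans[OF norm_cinner_le le] in auto)
qed

instantiation l2 :: ("{chilbert, second_countable_topology}") real_inner
begin

lift_definition zero_l2 :: "'a l2" is "\<lambda>_. 0" by simp
lift_definition plus_l2 :: "'a l2 \<Rightarrow> 'a l2 \<Rightarrow> 'a l2" is "\<lambda>f g \<zeta>. f \<zeta> + g \<zeta>"
  by (auto intro: square_integrable_add)
lift_definition minus_l2 :: "'a l2 \<Rightarrow> 'a l2 \<Rightarrow> 'a l2" is "\<lambda>f g \<zeta>. f \<zeta> - g \<zeta>"
  by (auto intro: square_integrable_diff)
lift_definition uminus_l2 :: "'a l2 \<Rightarrow> 'a l2" is "\<lambda>f \<zeta>. - f \<zeta>"
  by (auto intro: square_integrable_uminus)
lift_definition scaleR_l2 :: "real \<Rightarrow> 'a l2 \<Rightarrow> 'a l2" is "\<lambda>r f \<zeta>. r *\<^sub>R f \<zeta>"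
  unfolding scaleR_scaleC by (auto intro!: square_integrable_scaleC)
lift_definition inner_l2 :: "'a l2 \<Rightarrow> 'a l2 \<Rightarrow> real"
  is "\<lambda>f g. LINT \<zeta>|circle_measure. inner (f \<zeta>) (g \<zeta>)"
  by (rule integral_cong_AE) (auto dest: square_integrable_measurable)
definition "norm f = sqrt (inner f f)" for f :: "'a l2"
definition "sgn f = inverse (norm f) *\<^sub>R f" for f :: "'a l2"
definition "dist f g = norm (f - g)" for f g :: "'a l2"
definition [code del]: "(uniformity :: ('a l2 \<times> 'a l2) filter)
    = (INF e\<in>{0<..}. principal {(x, y). dist x y < e})"
definition [code del]: "open (U :: 'a l2 set)
    \<longleftrightarrow> (\<forall>x\<in>U. \<forall>\<^sub>F (x', y) in uniformity. x' = x \<longrightarrow> y \<in> U)"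

instance
proof
  fix f g h :: "'a l2" and r s :: real
  show "dist f g = norm (f - g)" "sgn f = inverse (norm f) *\<^sub>R f"
    "norm f = sqrt (inner f f)"
    "(uniformity :: ('a l2 \<times> 'a l2) filter) = (INF e\<in>{0<..}. principal {(x, y). dist x y < e})"
    "open U \<longleftrightarrow> (\<forall>x\<in>U. \<forall>\<^sub>F (x', y) in uniformity. x' = x \<longrightarrow> y \<in> U)" for U :: "'a l2 set"
    by (simp_all add: dist_l2_def sgn_l2_def norm_l2_def uniformity_l2_def open_l2_def)
  show "inner f g = inner g f"
    by transfer (simp add: inner_commute)
  show "inner (f + g) h = inner f h + inner g h"
    by transfer (simp add: inner_add_left square_integrable_cinner)
  show "inner (r *\<^sub>R f) g = r * inner f g"
    by transfer simp
  show "0 \<le> inner f f"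
    by transfer simp
  show "inner f f = 0 \<longleftrightarrow> f = 0"
    by transfer (simp add: integral_nonneg_eq_0_iff_AE square_integrable_cinner)
  show "f + g + h = f + (g + h)" "f + g = g + f" "0 + f = f" "- f + f = 0" "f - g = f + - g"
    "r *\<^sub>R (f + g) = r *\<^sub>R f + r *\<^sub>R g" "(r + s) *\<^sub>R f = r *\<^sub>R f + s *\<^sub>R f"
    "r *\<^sub>R s *\<^sub>R f = (r * s) *\<^sub>R f" "1 *\<^sub>R f = f"
    by (transfer; auto simp: algebra_simps scaleR_scaleC
          intro!: square_integrable_add square_integrable_diff square_integrable_uminus
            square_integrable_scaleC)+
qed

end

lemma square_integrable_rep [simp]: "square_integrable (rep_l2 f)"
  using Quotient3_rep_reflp[OF Quotient3_l2, of f] by simp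

lemma rep_abs_l2: "square_integrable f \<Longrightarrow> AE \<zeta> in circle_measure. rep_l2 (abs_l2 f) \<zeta> = f \<zeta>"
  using Quotient3_rep_abs[OF Quotient3_l2, of f] by simp

lemma abs_rep_l2: "abs_l2 (rep_l2 f) = f"
  by (rule Quotient3_abs_rep[OF Quotient3_l2])

lemma l2_norm_diff:
  assumes "square_integrable g"
  shows "ennreal ((norm (f - abs_l2 g))\<^sup>2)
    = (\<integral>\<^sup>+\<zeta>. ennreal ((norm (rep_l2 f \<zeta> - g \<zeta>))\<^sup>2) \<partial>circle_measure)"
proof -
  have s: "square_integrable (\<lambda>\<zeta>. rep_l2 f \<zeta> - g \<zeta>)"
    by (simp add: assms square_integrable_diff)
  have "f - abs_l2 g = abs_l2 (\<lambda>\<zeta>. rep_l2 f \<zeta> - g \<zeta>)"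
    using minus_l2.abs_eq[of "rep_l2 f" g] assms by (simp add: abs_rep_l2)
  then have "(norm (f - abs_l2 g))\<^sup>2
      = (LINT \<zeta>|circle_measure. (norm (rep_l2 f \<zeta> - g \<zeta>))\<^sup>2)"
    using inner_l2.abs_eq[of "\<lambda>\<zeta>. rep_l2 f \<zeta> - g \<zeta>" "\<lambda>\<zeta>. rep_l2 f \<zeta> - g \<zeta>"] s
    by (simp add: power2_norm_eq_inner)
  then show ?thesis
    using s by (simp add: nn_integral_eq_integral square_integrable_def)
qed

instance l2 :: ("{chilbert, second_countable_topology}") banach
proof
  fix X :: "nat \<Rightarrow> 'a l2"
  assume X: "Cauchy X"
  define f where "f n = rep_l2 (X n)" for n
  have sf [simp]: "square_integrable (f n)" for n by (simp add: f_def)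
  have [measurable]: "f n \<in> borel_measurable circle_measure" for n
    by (rule square_integrable_measurable) simp
  have nf: "ennreal ((dist (X m) (X n))\<^sup>2)
      = (\<integral>\<^sup>+\<zeta>. ennreal ((norm (f m \<zeta> - f n \<zeta>))\<^sup>2) \<partial>circle_measure)" for m n
    using l2_norm_diff[of "f n" "X m"] by (simp add: f_def abs_rep_l2 dist_norm)
  have "\<forall>k. \<exists>M. \<forall>m\<ge>M. \<forall>n\<ge>M. dist (X m) (X n) < (1/2)^k"
    using X unfolding Cauchy_def by (meson half_gt_zero_iff zero_less_one zero_less_power)
  then obtain M where M: "\<And>k m n. m \<ge> M k \<Longrightarrow> n \<ge> M k \<Longrightarrow> dist (X m) (X n) < (1/2)^k"
    by metis
  define r where "r k = k + (\<Sum>i\<le>k. M i)" for k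
  have rM: "r k \<ge> M k" for k
    using member_le_sum[of k "{..k}" M] by (simp add: r_def)
  have "strict_mono r"
    by (rule strict_monoI_Suc) (simp add: r_def)
  define d where "d k \<zeta> = f (r (Suc k)) \<zeta> - f (r k) \<zeta>" for k \<zeta>
  have dm [measurable]: "d k \<in> borel_measurable circle_measure" for k
    unfolding d_def by measurable
  have nd: "(\<integral>\<^sup>+\<zeta>. ennreal (norm (d k \<zeta>)) \<partial>circle_measure) \<le> ennreal ((1/2)^k)" for k
  proof -
    define c :: real where "c = (1/2)^k"
    have c: "c > 0" by (simp add: c_def)
    have "r k \<le> r (Suc k)" using \<open>strict_mono r\<close> by (simp add: strict_mono_less_eq)
    then have dd: "dist (X (r (Suc k))) (X (r k)) \<le> c"
      unfolding c_def using M[of k "r (Suc k)" "r k"] rM[of k] by simp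
    have "norm (d k \<zeta>) \<le> c / 2 + (norm (d k \<zeta>))\<^sup>2 / (2 * c)" for \<zeta>
      using sum_squares_bound[of c "norm (d k \<zeta>)"] c
      by (simp add: field_simps power2_eq_square)
    then have "(\<integral>\<^sup>+\<zeta>. ennreal (norm (d k \<zeta>)) \<partial>circle_measure)
        \<le> (\<integral>\<^sup>+\<zeta>. ennreal (c / 2) + ennreal (1 / (2 * c)) * ennreal ((norm (d k \<zeta>))\<^sup>2) \<partial>circle_measure)"
      using c by (intro nn_integral_mono)
        (simp add: ennreal_mult[symmetric] ennreal_plus[symmetric] del: ennreal_plus)
    also have "\<dots> = ennreal (c / 2)
        + ennreal (1 / (2 * c)) * (\<integral>\<^sup>+\<zeta>. ennreal ((norm (d k \<zeta>))\<^sup>2) \<partial>circle_measure)"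
      by (simp add: nn_integral_add nn_integral_cmult)
    also have "(\<integral>\<^sup>+\<zeta>. ennreal ((norm (d k \<zeta>))\<^sup>2) \<partial>circle_measure)
        = ennreal ((dist (X (r (Suc k))) (X (r k)))\<^sup>2)"
      by (simp add: nf d_def)
    also have "\<dots> \<le> ennreal (c\<^sup>2)"
      using dd by (intro ennreal_leI power_mono) auto
    also have "ennreal (c / 2) + ennreal (1 / (2 * c)) * ennreal (c\<^sup>2) = ennreal c"
      using c by (simp add: ennreal_mult[symmetric] ennreal_plus[symmetric] power2_eq_square
          del: ennreal_plus)
    finally show ?thesis
      by (simp add: c_def add_left_mono mult_left_mono)
  qed
  have "(\<integral>\<^sup>+\<zeta>. (\<Sum>k. ennreal (norm (d k \<zeta>))) \<partial>circle_measure)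
      = (\<Sum>k. \<integral>\<^sup>+\<zeta>. ennreal (norm (d k \<zeta>)) \<partial>circle_measure)"
    by (rule nn_integral_suminf) measurable
  also have "\<dots> \<le> (\<Sum>k. ennreal ((1/2)^k))"
    by (intro suminf_le nd) auto
  also have "\<dots> = ennreal 2"
    using suminf_geometric[of "1/2::real"]
    by (subst suminf_ennreal2) (auto intro!: summable_geometric)
  finally have "(\<integral>\<^sup>+\<zeta>. (\<Sum>k. ennreal (norm (d k \<zeta>))) \<partial>circle_measure) \<noteq> \<infinity>"
    by (auto simp: top_unique)
  then have "AE \<zeta> in circle_measure. (\<Sum>k. ennreal (norm (d k \<zeta>))) \<noteq> \<infinity>"
    by (intro nn_integral_PInf_AE) measurable
  then have conv: "AE \<zeta> in circle_measure. (\<lambda>k. f (r k) \<zeta>) \<longlonglongrightarrow> lim (\<lambda>k. f (r k) \<zeta>)"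
  proof eventually_elim
    case (elim \<zeta>)
    have "summable (\<lambda>k. norm (d k \<zeta>))"
      by (rule summable_suminf_not_top) (use elim in auto)
    then have "summable (\<lambda>k. d k \<zeta>)" by (rule summable_norm_cancel)
    then have "convergent (\<lambda>n. \<Sum>k<n. d k \<zeta>)" by (simp add: summable_iff_convergent)
    moreover have "(\<Sum>k<n. d k \<zeta>) = f (r n) \<zeta> - f (r 0) \<zeta>" for n
      unfolding d_def by (rule sum_lessThan_telescope)
    ultimately have "convergent (\<lambda>n. f (r n) \<zeta>)"
      by (simp add: convergent_diff_const_right_iff)
    then show ?case by (simp add: convergent_LIMSEQ_iff)
  qed
  define g where "g \<zeta> = lim (\<lambda>k. f (r k) \<zeta>)" for \<zeta>
  have [measurable]: "g \<in> borel_measurable circle_measure"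
    unfolding g_def by measurable
  have fatou: "(\<integral>\<^sup>+\<zeta>. ennreal ((norm (f n \<zeta> - g \<zeta>))\<^sup>2) \<partial>circle_measure) \<le> ennreal (e\<^sup>2)"
    if N: "\<forall>m\<ge>N. \<forall>n\<ge>N. dist (X m) (X n) < e" "n \<ge> N" for N n e
  proof -
    have "AE \<zeta> in circle_measure. ennreal ((norm (f n \<zeta> - g \<zeta>))\<^sup>2)
        = liminf (\<lambda>k. ennreal ((norm (f n \<zeta> - f (r k) \<zeta>))\<^sup>2))"
      using conv
    proof eventually_elim
      case (elim \<zeta>)
      have "(\<lambda>k. ennreal ((norm (f n \<zeta> - f (r k) \<zeta>))\<^sup>2)) \<longlonglongrightarrow> ennreal ((norm (f n \<zeta> - g \<zeta>))\<^sup>2)"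
        unfolding g_def by (intro tendsto_intros tendsto_ennrealI elim)
      then show ?case by (intro lim_imp_Liminf[symmetric]) auto
    qed
    then have "(\<integral>\<^sup>+\<zeta>. ennreal ((norm (f n \<zeta> - g \<zeta>))\<^sup>2) \<partial>circle_measure)
        = (\<integral>\<^sup>+\<zeta>. liminf (\<lambda>k. ennreal ((norm (f n \<zeta> - f (r k) \<zeta>))\<^sup>2)) \<partial>circle_measure)"
      by (rule nn_integral_cong_AE)
    also have "\<dots> \<le> liminf (\<lambda>k. \<integral>\<^sup>+\<zeta>. ennreal ((norm (f n \<zeta> - f (r k) \<zeta>))\<^sup>2) \<partial>circle_measure)"
      by (rule nn_integral_liminf) measurable
    also have "\<dots> \<le> liminf (\<lambda>k::nat. ennreal (e\<^sup>2))"
    proof (rule Liminf_mono)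
      have "eventually (\<lambda>k. k \<ge> N) sequentially" by (rule eventually_ge_at_top)
      then show "\<forall>\<^sub>F k in sequentially.
          (\<integral>\<^sup>+\<zeta>. ennreal ((norm (f n \<zeta> - f (r k) \<zeta>))\<^sup>2) \<partial>circle_measure) \<le> ennreal (e\<^sup>2)"
      proof eventually_elim
        case (elim k)
        then have "r k \<ge> N" using seq_suble[OF \<open>strict_mono r\<close>, of k] by simp
        then have "dist (X n) (X (r k)) \<le> e" using N by (simp add: less_imp_le)
        then show ?case
          unfolding nf[symmetric] by (intro ennreal_leI power_mono) auto
      qed
    qed
    finally show ?thesis by (simp add: Liminf_const)
  qed
  have sg: "square_integrable g"
  proof -
    obtain N where N: "\<forall>m\<ge>N. \<forall>n\<ge>N. dist (X m) (X n) < 1"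
      using X unfolding Cauchy_def by (meson zero_less_one)
    have "(\<integral>\<^sup>+\<zeta>. ennreal ((norm (f N \<zeta> - g \<zeta>))\<^sup>2) \<partial>circle_measure) < \<infinity>"
      using fatou[OF N order_refl] by (rule le_less_trans) simp
    then have "square_integrable (\<lambda>\<zeta>. f N \<zeta> - g \<zeta>)"
      unfolding square_integrable_def by (auto intro!: integrableI_bounded)
    from square_integrable_diff[OF sf[of N] this] show ?thesis by simp
  qed
  have "X \<longlonglongrightarrow> abs_l2 g"
    unfolding LIMSEQ_def
  proof (intro allI impI)
    fix e :: real assume e: "0 < e"
    then obtain N where N: "\<forall>m\<ge>N. \<forall>n\<ge>N. dist (X m) (X n) < e / 2"
      using X unfolding Cauchy_def by (meson half_gt_zero)
    have "dist (X n) (abs_l2 g) < e" if "n \<ge> N" for n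
    proof -
      have "ennreal ((dist (X n) (abs_l2 g))\<^sup>2) \<le> ennreal ((e / 2)\<^sup>2)"
        using fatou[OF N that] l2_norm_diff[OF sg, of "X n"] by (simp add: dist_norm f_def)
      then have "(dist (X n) (abs_l2 g))\<^sup>2 \<le> (e / 2)\<^sup>2"
        by (simp add: ennreal_le_iff del: power_divide)
      then have "dist (X n) (abs_l2 g) \<le> e / 2"
        by (rule power2_le_imp_le) (use e in simp)
      then show ?thesis using e by simp
    qed
    then show "\<exists>N. \<forall>n\<ge>N. dist (X n) (abs_l2 g) < e" by blast
  qed
  then show "convergent X" by (auto simp: convergent_def)
qed

instantiation l2 :: ("{chilbert, second_countable_topology}") chilbert
begin

lift_definition scaleC_l2 :: "complex \<Rightarrow> 'a l2 \<Rightarrow> 'a l2" is "\<lambda>c f \<zeta>. c *\<^sub>C f \<zeta>"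
  by (auto intro!: square_integrable_scaleC)
lift_definition cinner_l2 :: "'a l2 \<Rightarrow> 'a l2 \<Rightarrow> complex"
  is "\<lambda>f g. LINT \<zeta>|circle_measure. cinner (f \<zeta>) (g \<zeta>)"
  by (rule integral_cong_AE) (auto dest: square_integrable_measurable)

instance
proof
  fix f g h :: "'a l2" and c d :: complex and r :: real
  show "cinner (f + g) h = cinner f h + cinner g h"
    by transfer (simp add: cinner_add_left square_integrable_cinner)
  show "cinner (c *\<^sub>C f) g = c * cinner f g"
    by transfer (simp add: cinner_scaleC_left)
  show "cinner f g = cnj (cinner g f)"
  proof transfer
    fix f g :: "complex \<Rightarrow> 'a"
    have "(\<lambda>\<zeta>. cinner (f \<zeta>) (g \<zeta>)) = (\<lambda>\<zeta>. cnj (cinner (g \<zeta>) (f \<zeta>)))"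
      by (rule ext) (rule cinner_commute)
    then show "(LINT \<zeta>|circle_measure. cinner (f \<zeta>) (g \<zeta>))
        = cnj (LINT \<zeta>|circle_measure. cinner (g \<zeta>) (f \<zeta>))"
      by simp
  qed
  show "Re (cinner f g) = inner f g"
    by transfer (subst integral_Re[symmetric], simp_all add: square_integrable_cinner Re_cinner)
  show "c *\<^sub>C (f + g) = c *\<^sub>C f + c *\<^sub>C g" "(c + d) *\<^sub>C f = c *\<^sub>C f + d *\<^sub>C f"
    "c *\<^sub>C d *\<^sub>C f = (c * d) *\<^sub>C f" "r *\<^sub>R f = complex_of_real r *\<^sub>C f"
    by (transfer; auto simp: scaleC_add_right scaleC_add_left scaleC_scaleC scaleR_scaleC
          intro!: square_integrable_add square_integrable_scaleC)+
qed

end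

definition clinear_on :: "'a::chilbert set \<Rightarrow> ('a \<Rightarrow> 'b::chilbert) \<Rightarrow> bool" where
  "clinear_on S A \<longleftrightarrow> (\<forall>x\<in>S. \<forall>y\<in>S. A (x + y) = A x + A y) \<and> (\<forall>c. \<forall>x\<in>S. A (c *\<^sub>C x) = c *\<^sub>C A x)"

definition bounded_clinear_on :: "'a::chilbert set \<Rightarrow> 'b::chilbert set \<Rightarrow> ('a \<Rightarrow> 'b) \<Rightarrow> bool" where
  "bounded_clinear_on S T A \<longleftrightarrow>
     A \<in> S \<rightarrow> T \<and> clinear_on S A \<and> (\<exists>K. \<forall>x\<in>S. norm (A x) \<le> K * norm x)"

definition isometry_on :: "'a::chilbert set \<Rightarrow> 'b::chilbert set \<Rightarrow> ('a \<Rightarrow> 'b) \<Rightarrow> bool" where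
  "isometry_on S T A \<longleftrightarrow> A \<in> S \<rightarrow> T \<and> clinear_on S A \<and> (\<forall>x\<in>S. norm (A x) = norm x)"

definition unitary_on :: "'a::chilbert set \<Rightarrow> 'b::chilbert set \<Rightarrow> ('a \<Rightarrow> 'b) \<Rightarrow> bool" where
  "unitary_on S T A \<longleftrightarrow> isometry_on S T A \<and> A ` S = T"

definition closed_csubspace :: "'a::chilbert set \<Rightarrow> bool" where
  "closed_csubspace S \<longleftrightarrow> csubspace S \<and> closed S"

text \<open>\<^term>\<open>adj_on S A\<close> is the adjoint of a bounded operator \<^term>\<open>A\<close> whose domain is the
  closed subspace \<^term>\<open>S\<close>; its values lie in \<^term>\<open>S\<close>.\<close>

definition adj_on :: "'a::chilbert set \<Rightarrow> ('a \<Rightarrow> 'b::chilbert) \<Rightarrow> 'b \<Rightarrow> 'a" where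
  "adj_on S A y = (THE x. x \<in> S \<and> (\<forall>s\<in>S. cinner (A s) y = cinner s x))"

abbreviation adj :: "('a::chilbert \<Rightarrow> 'b::chilbert) \<Rightarrow> 'b \<Rightarrow> 'a" where
  "adj \<equiv> adj_on UNIV"

text \<open>The positive square root of a positive bounded operator on the closed subspace
  \<^term>\<open>S\<close>; extensionality makes it unique as a function on the ambient type.\<close>

definition psqrt_on :: "'a::chilbert set \<Rightarrow> ('a \<Rightarrow> 'a) \<Rightarrow> 'a \<Rightarrow> 'a" where
  "psqrt_on S A = (THE B. B \<in> extensional S \<and> bounded_clinear_on S S B \<and>
     (\<forall>x\<in>S. cinner (B x) x \<in> \<real>\<^sub>\<ge>\<^sub>0) \<and> (\<forall>x\<in>S. B (B x) = A x))"

definition contraction :: "('a::chilbert \<Rightarrow> 'a) \<Rightarrow> bool" where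
  "contraction P \<longleftrightarrow> clinear_on UNIV P \<and> (\<forall>x. norm (P x) \<le> norm x)"

definition reducing :: "'a::chilbert set \<Rightarrow> ('a \<Rightarrow> 'a) \<Rightarrow> bool" where
  "reducing M P \<longleftrightarrow> closed_csubspace M \<and> P ` M \<subseteq> M \<and> adj P ` M \<subseteq> M"

definition cnu :: "('a::chilbert \<Rightarrow> 'a) \<Rightarrow> bool" where
  "cnu P \<longleftrightarrow> \<not> (\<exists>M. M \<noteq> {0} \<and> reducing M P \<and> unitary_on M M P)"

definition isometric_dilation ::
  "'k::chilbert set \<Rightarrow> ('k \<Rightarrow> 'k) \<Rightarrow> ('h::chilbert \<Rightarrow> 'k) \<Rightarrow> ('h \<Rightarrow> 'h) \<Rightarrow> bool" where
  "isometric_dilation K V \<pi> P \<longleftrightarrow> isometry_on K K V \<and> isometry_on UNIV K \<pi> \<and>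
     (\<forall>h. \<pi> (adj P h) = adj_on K V (\<pi> h))"

definition minimal_dilation ::
  "'k::chilbert set \<Rightarrow> ('k \<Rightarrow> 'k) \<Rightarrow> ('h::chilbert \<Rightarrow> 'k) \<Rightarrow> bool" where
  "minimal_dilation K V \<pi> \<longleftrightarrow> K = closure (cspan {(V ^^ m) (\<pi> h) | m h. True})"

definition h2_on :: "'a::chilbert set \<Rightarrow> 'a h2 set" where
  "h2_on E = {f. \<forall>z\<in>ball 0 1. h2_fun f z \<in> E}"

definition l2_on :: "'a::{chilbert, second_countable_topology} set \<Rightarrow> 'a l2 set" where
  "l2_on E = {f. AE \<zeta> in circle_measure. rep_l2 f \<zeta> \<in> E}"

definition mult_z :: "'a::chilbert h2 \<Rightarrow> 'a h2" where
  "mult_z f = Abs_h2 (\<lambda>z. z *\<^sub>C h2_fun f z)"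

lemma h2_fun_mult_z: "h2_fun (mult_z f) z = z *\<^sub>C h2_fun f z"
proof -
  let ?a = "case_nat 0 (h2_coeff f)"
  have a: "square_summable ?a"
    using square_summable_coeff[of f] unfolding square_summable_def
    by (subst summable_Suc_iff[symmetric]) simp
  have "disc_series ?a w = w *\<^sub>C h2_fun f w" for w
  proof (cases "cmod w < 1")
    case True
    have "(\<lambda>n. w *\<^sub>C w ^ n *\<^sub>C h2_coeff f n) sums (w *\<^sub>C h2_fun f w)"
      by (intro bounded_linear.sums[OF bounded_bilinear.bounded_linear_right[OF
            bounded_bilinear_scaleC]] h2_fun_sums True)
    then have "(\<lambda>n. w ^ Suc n *\<^sub>C ?a (Suc n)) sums (w *\<^sub>C h2_fun f w)"
      by (simp add: scaleC_scaleC)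
    then have "(\<lambda>n. w ^ n *\<^sub>C ?a n) sums (w *\<^sub>C h2_fun f w)"
      by (subst (asm) sums_Suc_iff) simp
    then show ?thesis using True by (simp add: disc_series_def sums_unique[symmetric])
  next
    case False
    then show ?thesis by (simp add: disc_series_def h2_fun_coeff)
  qed
  then have "(\<lambda>z. z *\<^sub>C h2_fun f z) = disc_series ?a" by auto
  with a show ?thesis
    unfolding mult_z_def by (subst Abs_h2_inverse) auto
qed

lift_definition mult_eit ::
  "'a::{chilbert, second_countable_topology} l2 \<Rightarrow> 'a l2" is "\<lambda>f \<zeta>. \<zeta> *\<^sub>C f \<zeta>"
  using AE_circle_measure by (auto intro!: square_integrable_scaleC[where C = 1])

text \<open>\<^term>\<open>id_tensor A\<close> is the operator written \<open>I \<otimes> A\<close> when the vector-valued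
  Hardy space is identified with the tensor product of the scalar one and the coefficient space:
  it maps \<open>z\<^sup>n \<eta>\<close> to \<open>z\<^sup>n (A \<eta>)\<close>, i.e. applies \<^term>\<open>A\<close> pointwise. Here \<^term>\<open>A\<close> is
  bounded and linear on a closed subspace containing the values of the argument.\<close>

definition id_tensor :: "('a::chilbert \<Rightarrow> 'b::chilbert) \<Rightarrow> 'a h2 \<Rightarrow> 'b h2" where
  "id_tensor A f = Abs_h2 (\<lambda>z. A (h2_fun f z))"

definition radial_limit :: "(complex \<Rightarrow> 'a::t2_space) \<Rightarrow> complex \<Rightarrow> 'a" where
  "radial_limit F \<zeta> = Lim (at_left 1) (\<lambda>r. F (complex_of_real r * \<zeta>))"

definition defect :: "('a::chilbert \<Rightarrow> 'a) \<Rightarrow> 'a \<Rightarrow> 'a" where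
  "defect P = psqrt_on UNIV (\<lambda>x. x - adj P (P x))"

definition defect_adj :: "('a::chilbert \<Rightarrow> 'a) \<Rightarrow> 'a \<Rightarrow> 'a" where
  "defect_adj P = psqrt_on UNIV (\<lambda>x. x - P (adj P x))"

definition defect_space :: "('a::chilbert \<Rightarrow> 'a) \<Rightarrow> 'a set" where
  "defect_space P = closure (range (defect P))"

definition defect_adj_space :: "('a::chilbert \<Rightarrow> 'a) \<Rightarrow> 'a set" where
  "defect_adj_space P = closure (range (defect_adj P))"

text \<open>The characteristic function is meaningful on \<^term>\<open>defect_space P\<close> only.\<close>

definition char_fun :: "('a::chilbert \<Rightarrow> 'a) \<Rightarrow> complex \<Rightarrow> 'a \<Rightarrow> 'a" where
  "char_fun P z x = - P x + z *\<^sub>C defect_adj P (inv (\<lambda>y. y - z *\<^sub>C adj P y) (defect P x))"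

text \<open>On the circle the characteristic function is its strong radial limit, which exists almost
  everywhere because the space is separable.\<close>

definition char_bdry :: "('a::chilbert \<Rightarrow> 'a) \<Rightarrow> complex \<Rightarrow> 'a \<Rightarrow> 'a" where
  "char_bdry P \<zeta> x = radial_limit (\<lambda>z. char_fun P z x) \<zeta>"

definition Delta :: "('a::chilbert \<Rightarrow> 'a) \<Rightarrow> complex \<Rightarrow> 'a \<Rightarrow> 'a" where
  "Delta P \<zeta> = psqrt_on (defect_space P)
     (\<lambda>x. x - adj_on (defect_space P) (char_bdry P \<zeta>) (char_bdry P \<zeta> x))"

text \<open>Elements of \<^typ>\<open>'a l2\<close> are almost-everywhere classes and \<^term>\<open>rep_l2\<close> picks a
  representative; the multiplication by \<^term>\<open>Delta P\<close> is expressed as an almost-everywhere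
  identity between representatives.\<close>

definition Delta_range ::
  "('a::{chilbert, second_countable_topology} \<Rightarrow> 'a) \<Rightarrow> 'a l2 set" where
  "Delta_range P = {g. \<exists>f\<in>l2_on (defect_space P).
     AE \<zeta> in circle_measure. rep_l2 g \<zeta> = Delta P \<zeta> (rep_l2 f \<zeta>)}"

definition NF_space ::
  "('a::{chilbert, second_countable_topology} \<Rightarrow> 'a) \<Rightarrow> ('a h2 \<times> 'a l2) set" where
  "NF_space P = h2_on (defect_adj_space P) \<times> closure (Delta_range P)"

definition NF_S ::
  "('a::{chilbert, second_countable_topology} \<Rightarrow> 'a) \<Rightarrow> ('a h2 \<times> 'a l2) set" where
  "NF_S P = {(g, k). \<exists>f\<in>h2_on (defect_space P).
     (\<forall>z\<in>ball 0 1. h2_fun g z = char_fun P z (h2_fun f z)) \<and>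
     (AE \<zeta> in circle_measure. rep_l2 k \<zeta> = Delta P \<zeta> (radial_limit (h2_fun f) \<zeta>))}"

definition NF_Q ::
  "('a::{chilbert, second_countable_topology} \<Rightarrow> 'a) \<Rightarrow> ('a h2 \<times> 'a l2) set" where
  "NF_Q P = {x \<in> NF_space P. \<forall>s\<in>NF_S P. cinner x s = 0}"

definition NF_shift :: "'a::{chilbert, second_countable_topology} h2 \<times> 'a l2 \<Rightarrow> 'a h2 \<times> 'a l2" where
  "NF_shift = map_prod mult_z mult_eit"

definition NF_dilation ::
  "('a::{chilbert, second_countable_topology} \<Rightarrow> 'a) \<Rightarrow> ('a \<Rightarrow> 'a h2 \<times> 'a l2) \<Rightarrow> bool" where
  "NF_dilation P \<pi> \<longleftrightarrow> isometric_dilation (NF_space P) NF_shift \<pi> P \<and>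
     minimal_dilation (NF_space P) NF_shift \<pi> \<and> range \<pi> = NF_Q P"

text \<open>The isometry \<^term>\<open>\<omega>\<close> is the unitary identification of the space of \<^term>\<open>V\<close> with the
  direct sum of \<^term>\<open>h2_on E\<close> and \<^term>\<open>K\<^sub>u\<close> under which \<^term>\<open>V\<close> becomes
  \<^term>\<open>map_prod mult_z U\<close>.\<close>

definition wold_decomposition ::
  "('k::chilbert \<Rightarrow> 'k) \<Rightarrow> 'e::chilbert set \<Rightarrow> 'u::chilbert set \<Rightarrow> ('u \<Rightarrow> 'u) \<Rightarrow> ('k \<Rightarrow> 'e h2 \<times> 'u) \<Rightarrow> bool" where
  "wold_decomposition V E K\<^sub>u U \<omega> \<longleftrightarrow>
     closed_csubspace E \<and> closed_csubspace K\<^sub>u \<and> unitary_on K\<^sub>u K\<^sub>u U \<and>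
     unitary_on UNIV (h2_on E \<times> K\<^sub>u) \<omega> \<and> (\<forall>k. \<omega> (V k) = map_prod mult_z U (\<omega> k))"

text \<open>The isometry acts on \<^term>\<open>NF_space P\<close>, a subset of its type; requiring it to be
  extensional makes its uniqueness an equality of functions.\<close>

definition NF_factor ::
  "('h::{chilbert, second_countable_topology} \<Rightarrow> 'h) \<Rightarrow> ('h \<Rightarrow> 'h h2 \<times> 'h l2) \<Rightarrow>
   ('k::chilbert \<Rightarrow> 'k) \<Rightarrow> ('h \<Rightarrow> 'k) \<Rightarrow> ('h h2 \<times> 'h l2 \<Rightarrow> 'k) \<Rightarrow> bool" where
  "NF_factor P \<pi>NF V \<pi> \<Phi> \<longleftrightarrow> \<Phi> \<in> extensional (NF_space P) \<and> isometry_on (NF_space P) UNIV \<Phi> \<and>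
     \<pi> = \<Phi> \<circ> \<pi>NF \<and> (\<forall>x\<in>NF_space P. \<Phi> (adj_on (NF_space P) NF_shift x) = adj V (\<Phi> x))"

end

theory Submission
  imports Defs
begin

text \<open>Write \<open>S = M\<^sub>z \<oplus> M\<^sub>e\<^sub>i\<^sub>t\<close> for the model operator. For every isometric dilation \<open>V\<close> of \<open>P\<close>,
  the relation \<open>\<Pi> P\<^sup>* = V\<^sup>* \<Pi>\<close> gives \<open>\<langle>V\<^sup>m \<Pi> h, V\<^sup>n \<Pi> k\<rangle> = \<langle>h, P\<^sup>*\<^sup>(\<^sup>m\<^sup>-\<^sup>n\<^sup>) k\<rangle>\<close> for \<open>m \<ge> n\<close>, so
  these inner products depend on \<open>P\<close> alone (\<open>dilation_cinner\<close>). The vectors \<open>S\<^sup>m \<Pi>\<^sub>N\<^sub>F h\<close> have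
  a dense span by minimality; sending them to \<open>V\<^sup>m \<Pi> h\<close> therefore extends to an isometry
  \<open>\<Phi>\<close> (\<open>dilation_factor_exists\<close>). It intertwines the adjoints since both of them lower \<open>m\<close>
  and act on the vectors with \<open>m = 0\<close> through \<open>P\<^sup>*\<close>. Conversely, an isometry with
  \<open>\<Phi> S\<^sup>* = V\<^sup>* \<Phi>\<close> also satisfies \<open>\<Phi> S = V \<Phi>\<close> (\<open>adj_intertwiner_intertwines\<close>), so it is
  determined by its values on the range of \<open>\<Pi>\<^sub>N\<^sub>F\<close>; this is the uniqueness.

  For the second part, \<open>\<Phi>\<close> maps the kernel of \<open>S\<^sup>*\<close> into the kernel of \<open>V\<^sup>*\<close>, so constants in
  the first summand go to constants in the first summand, and \<open>\<Phi> S = V \<Phi>\<close> carries this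
  over to all coefficients. The second summand goes to the vectors that lie in the range of
  all powers of \<open>V\<close>, on which the shift part vanishes
  (\<open>shift_unitary_intertwiner_decomposes\<close>).

  The latter requires that multiplication by \<open>e\<^sup>i\<^sup>t\<close> is onto on the closure of \<open>\<Delta>\<^sub>P L\<^sup>2\<close>. By
  minimality this closure is a closed subspace, and because its definition is pointwise,
  it is invariant under cutting functions to Borel sets; such a subspace is invariant under
  every bounded multiplier, in particular under the conjugate of \<open>e\<^sup>i\<^sup>t\<close>
  (\<open>l2_mult_mem_if_indicator\<close>, \<open>mult_eit_surj_closure_Delta_range\<close>).\<close>

section \<open>Closed subspaces and adjoints of isometries\<close>

lemma cinner_zero_left [simp]: "cinner 0 y = 0"
  and cinner_zero_right [simp]: "cinner x 0 = 0" for x y :: "'a::chilbert"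
  using cinner_add_left[of 0 0 y] cinner_add_right[of x 0 0] by simp_all

lemma cinner_minus_left: "cinner (- x) y = - cinner x y" for x y :: "'a::chilbert"
  using cinner_add_left[of x "- x" y] by (simp add: eq_neg_iff_add_eq_0 add.commute)

lemma cinner_minus_right: "cinner x (- y) = - cinner x y" for x y :: "'a::chilbert"
  using cinner_add_right[of x y "- y"] by (simp add: eq_neg_iff_add_eq_0 add.commute)

lemma cinner_diff_left: "cinner (x - y) z = cinner x z - cinner y z" for x y z :: "'a::chilbert"
  using cinner_add_left[of x "- y" z] by (simp add: cinner_minus_left)

lemma cinner_diff_right: "cinner x (y - z) = cinner x y - cinner x z" for x y z :: "'a::chilbert"
  using cinner_add_right[of x y "- z"] by (simp add: cinner_minus_right)

lemma cinner_self_eq_0 [simp]: "cinner x x = 0 \<longleftrightarrow> x = 0" for x :: "'a::chilbert"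
  by (simp add: cinner_self)

lemma scaleC_zero_left [simp]: "0 *\<^sub>C x = 0"
  and scaleC_zero_right [simp]: "c *\<^sub>C 0 = (0 :: 'a)" for x :: "'a::chilbert"
  by (rule complex_vector.scale_zero_left complex_vector.scale_zero_right)+

lemmas tendsto_scaleC = bounded_bilinear.tendsto[OF bounded_bilinear_scaleC]

lemma cinner_eqI:
  fixes x y :: "'a::chilbert"
  assumes "x \<in> S" "y \<in> S" "csubspace S" "\<And>s. s \<in> S \<Longrightarrow> cinner s x = cinner s y"
  shows "x = y"
proof -
  have "x - y \<in> S" using assms by (simp add: complex_vector.subspace_diff)
  then have "cinner (x - y) (x - y) = 0"
    using assms(4)[of "x - y"] by (simp add: cinner_diff_right)
  then show ?thesis by simp
qed

lemma closed_csubspaceD: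
  assumes "closed_csubspace S"
  shows "csubspace S" "closed S" "0 \<in> S"
    "\<And>x y. x \<in> S \<Longrightarrow> y \<in> S \<Longrightarrow> x + y \<in> S" "\<And>x y. x \<in> S \<Longrightarrow> y \<in> S \<Longrightarrow> x - y \<in> S"
    "\<And>c x. x \<in> S \<Longrightarrow> c *\<^sub>C x \<in> S"
  using assms unfolding closed_csubspace_def
  by (auto intro: complex_vector.subspace_0 complex_vector.subspace_add
      complex_vector.subspace_diff complex_vector.subspace_scale)

lemma closed_csubspace_UNIV: "closed_csubspace UNIV"
  by (simp add: closed_csubspace_def complex_vector.subspace_UNIV)

lemma closed_csubspace_closure:
  assumes "csubspace S"
  shows "closed_csubspace (closure S)"
  unfolding closed_csubspace_def
proof
  show "csubspace (closure S)"
  proof (rule complex_vector.subspaceI)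
    show "0 \<in> closure S"
      using assms closure_subset complex_vector.subspace_0 by blast
  next
    fix x y assume "x \<in> closure S" "y \<in> closure S"
    then obtain a b where "\<And>n. a n \<in> S" "a \<longlonglongrightarrow> x" "\<And>n. b n \<in> S" "b \<longlonglongrightarrow> y"
      unfolding closure_sequential by blast
    moreover from this have "(\<lambda>n. a n + b n) \<longlonglongrightarrow> x + y" by (intro tendsto_add)
    ultimately show "x + y \<in> closure S"
      unfolding closure_sequential using complex_vector.subspace_add[OF assms]
      by (intro exI[of _ "\<lambda>n. a n + b n"]) simp
  next
    fix x c assume "x \<in> closure S"
    then obtain a where "\<And>n. a n \<in> S" "a \<longlonglongrightarrow> x"
      unfolding closure_sequential by blast
    moreover from this have "(\<lambda>n. c *\<^sub>C a n) \<longlonglongrightarrow> c *\<^sub>C x" by (intro tendsto_scaleC tendsto_const)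
    ultimately show "c *\<^sub>C x \<in> closure S"
      unfolding closure_sequential using complex_vector.subspace_scale[OF assms]
      by (intro exI[of _ "\<lambda>n. c *\<^sub>C a n"]) simp
  qed
qed simp

text \<open>A minimizing sequence for the distance is Cauchy by the parallelogram law, and the
  vector from its limit to \<open>x\<close> is orthogonal to the subspace because the distance cannot be
  decreased along any line.\<close>

lemma orthogonal_decomposition:
  fixes S :: "'a::chilbert set"
  assumes S: "closed_csubspace S"
  obtains p where "p \<in> S" "\<And>s. s \<in> S \<Longrightarrow> cinner s (x - p) = 0"
proof -
  note SD = closed_csubspaceD[OF S]
  define d where "d = infdist x S"
  have ne: "S \<noteq> {}" using SD(3) by blast
  have le: "d \<le> dist x s" if "s \<in> S" for s
    unfolding d_def using that by (rule infdist_le)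
  have d0: "0 \<le> d" by (simp add: d_def infdist_nonneg)
  have "\<exists>s\<in>S. dist x s < d + inverse (Suc n)" for n
    using cInf_lessD[of "dist x ` S" "d + inverse (Suc n)"] ne
    by (auto simp: d_def infdist_notempty)
  then obtain a where a: "\<And>n. a n \<in> S" "\<And>n. dist x (a n) < d + inverse (Suc n)"
    by metis
  have inv_le: "dist x (a n) \<le> d + inverse (Suc N)" if "n \<ge> N" for n N
    using a(2)[of n] that by (smt (verit) Suc_le_mono inverse_le_imp_le le_imp_inverse_le of_nat_0_less_iff of_nat_mono zero_less_Suc)
  have par: "(dist (a m) (a n))\<^sup>2 \<le> 4 * ((d + inverse (Suc N))\<^sup>2 - d\<^sup>2)" if "m \<ge> N" "n \<ge> N" for m n N
  proof -
    have mid: "(1/2) *\<^sub>R (a m + a n) \<in> S"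
      unfolding scaleR_scaleC by (intro SD a)
    have "(norm (a m - a n))\<^sup>2 + 4 * (norm (x - (1/2) *\<^sub>R (a m + a n)))\<^sup>2
        = 2 * (norm (x - a m))\<^sup>2 + 2 * (norm (x - a n))\<^sup>2"
      by (simp add: power2_norm_eq_inner inner_simps inner_commute field_simps)
    moreover have "d\<^sup>2 \<le> (norm (x - (1/2) *\<^sub>R (a m + a n)))\<^sup>2"
      using le[OF mid] d0 by (intro power_mono) (auto simp: dist_norm)
    moreover have "(norm (x - a k))\<^sup>2 \<le> (d + inverse (Suc N))\<^sup>2" if "k \<ge> N" for k
      using inv_le[OF that] by (intro power_mono) (auto simp: dist_norm)
    note this[OF \<open>m \<ge> N\<close>] this[OF \<open>n \<ge> N\<close>]
    ultimately show ?thesis by (simp add: dist_norm)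
  qed
  have "Cauchy a"
    unfolding Cauchy_def
  proof (intro allI impI)
    fix e :: real assume e: "0 < e"
    have "(\<lambda>N. 4 * ((d + inverse (real (Suc N)))\<^sup>2 - d\<^sup>2)) \<longlonglongrightarrow> 4 * ((d + 0)\<^sup>2 - d\<^sup>2)"
      by (intro tendsto_intros LIMSEQ_inverse_real_of_nat)
    then have "\<forall>\<^sub>F N in sequentially. 4 * ((d + inverse (real (Suc N)))\<^sup>2 - d\<^sup>2) < e\<^sup>2"
      using e by (intro order_tendstoD(2)) auto
    then obtain N where N: "4 * ((d + inverse (real (Suc N)))\<^sup>2 - d\<^sup>2) < e\<^sup>2"
      by (auto simp: eventually_sequentially)
    have "dist (a m) (a n) < e" if "m \<ge> N" "n \<ge> N" for m n
    proof -
      have "(dist (a m) (a n))\<^sup>2 < e\<^sup>2" using par[OF that] N by simp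
      then show ?thesis using e by (simp add: power_less_imp_less_base)
    qed
    then show "\<exists>M. \<forall>m\<ge>M. \<forall>n\<ge>M. dist (a m) (a n) < e" by blast
  qed
  then obtain p where p: "a \<longlonglongrightarrow> p" by (auto simp: Cauchy_convergent_iff convergent_def)
  have pS: "p \<in> S" using SD(2) a(1) p closed_sequentially by blast
  have "dist x p \<le> d"
  proof (rule LIMSEQ_le)
    show "(\<lambda>n. dist x (a n)) \<longlonglongrightarrow> dist x p" by (intro tendsto_intros p)
    show "(\<lambda>n. d + inverse (real (Suc n))) \<longlonglongrightarrow> d"
      using tendsto_add[OF tendsto_const LIMSEQ_inverse_real_of_nat, of d] by simp
  qed (use a(2) in \<open>auto intro: less_imp_le\<close>)
  then have dp: "norm (x - p) \<le> norm (x - s)" if "s \<in> S" for s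
    using le[OF that] by (simp add: dist_norm)
  have "cinner s (x - p) = 0" if s: "s \<in> S" for s
  proof (cases "s = 0")
    case False
    \<comment> \<open>\<open>t *\<^sub>C s\<close> is the orthogonal projection of \<open>x - p\<close> to the line through \<open>s\<close>\<close>
    define t where "t = cinner (x - p) s / of_real ((norm s)\<^sup>2)"
    have *: "cinner (x - p - t *\<^sub>C s) s = 0"
      using False by (simp add: t_def cinner_diff_left cinner_scaleC_left cinner_self)
    have "cinner (x - p - t *\<^sub>C s) (t *\<^sub>C s) = 0"
      using * by (simp add: cinner_scaleC_right)
    then have "inner (x - p - t *\<^sub>C s) (t *\<^sub>C s) = 0"
      by (metis Re_cinner zero_complex.simps(1))
    then have "(norm (x - p))\<^sup>2 = (norm (x - p - t *\<^sub>C s))\<^sup>2 + (norm (t *\<^sub>C s))\<^sup>2"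
      using norm_add_Pythagorean[of "x - p - t *\<^sub>C s" "t *\<^sub>C s"]
      by (simp add: orthogonal_def)
    moreover have "norm (x - p) \<le> norm (x - p - t *\<^sub>C s)"
      using dp[of "p + t *\<^sub>C s"] SD(4)[OF pS SD(6)[OF s, of t]] by (simp add: algebra_simps)
    then have "(norm (x - p))\<^sup>2 \<le> (norm (x - p - t *\<^sub>C s))\<^sup>2" by (intro power_mono) auto
    ultimately have "norm (t *\<^sub>C s) = 0"
      by (smt (verit) norm_eq_zero power2_less_eq_zero_iff zero_le_power2)
    then have "cinner (x - p) s = 0"
      using False by (auto simp: norm_scaleC t_def)
    then show ?thesis by (metis cinner_commute complex_cnj_zero)
  qed simp
  with pS show ?thesis by (rule that)
qed

text \<open>A closed subspace contains everything that is orthogonal to its orthogonal complement. In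
  this form membership reduces to scalar identities.\<close>

lemma mem_closed_csubspaceI:
  fixes S :: "'a::chilbert set"
  assumes S: "closed_csubspace S"
    and orth: "\<And>y. (\<And>s. s \<in> S \<Longrightarrow> cinner s y = 0) \<Longrightarrow> cinner x y = 0"
  shows "x \<in> S"
proof -
  obtain p where p: "p \<in> S" "\<And>s. s \<in> S \<Longrightarrow> cinner s (x - p) = 0"
    using orthogonal_decomposition[OF S, of x] by blast
  have "cinner (x - p) (x - p) = 0"
    using orth[OF p(2)] p by (simp add: cinner_diff_left)
  then show ?thesis using p(1) by simp
qed

lemma
  assumes "isometry_on S T A"
  shows isometry_on_mem: "x \<in> S \<Longrightarrow> A x \<in> T"
    and isometry_on_add: "x \<in> S \<Longrightarrow> y \<in> S \<Longrightarrow> A (x + y) = A x + A y"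
    and isometry_on_scaleC: "x \<in> S \<Longrightarrow> A (c *\<^sub>C x) = c *\<^sub>C A x"
    and isometry_on_norm: "x \<in> S \<Longrightarrow> norm (A x) = norm x"
  using assms by (auto simp: isometry_on_def clinear_on_def)

lemma isometry_on_zero:
  assumes "isometry_on S T A" "csubspace S"
  shows "A 0 = 0"
  using isometry_on_norm[OF assms(1)] complex_vector.subspace_0[OF assms(2)] by force

lemma isometry_on_diff:
  assumes "isometry_on S T A" "csubspace S" "x \<in> S" "y \<in> S"
  shows "A (x - y) = A x - A y"
proof -
  have "A (x - y + y) = A (x - y) + A y"
    by (rule isometry_on_add[OF assms(1) complex_vector.subspace_diff[OF assms(2-4)] assms(4)])
  then show ?thesis by simp
qed

lemma isometry_on_comp:
  assumes "isometry_on S T A" "isometry_on T R B"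
  shows "isometry_on S R (B \<circ> A)"
  using assms unfolding isometry_on_def clinear_on_def Pi_iff by simp

lemma isometry_on_cinner:
  assumes A: "isometry_on S T A" and S: "csubspace S" and x: "x \<in> S" and y: "y \<in> S"
  shows "cinner (A x) (A y) = cinner x y"
proof -
  have inner: "inner (A x) (A y) = inner x y" if y: "y \<in> S" for y
  proof -
    have "norm (A x + A y) = norm (x + y)"
      using isometry_on_norm[OF A] isometry_on_add[OF A x y] complex_vector.subspace_add[OF S x y]
      by metis
    then have "(norm (A x + A y))\<^sup>2 = (norm (x + y))\<^sup>2" by simp
    moreover have "(norm (A x))\<^sup>2 = (norm x)\<^sup>2" "(norm (A y))\<^sup>2 = (norm y)\<^sup>2"
      using isometry_on_norm[OF A] x y by simp_all
    ultimately show ?thesis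
      by (simp add: power2_norm_eq_inner inner_simps inner_commute)
  qed
  have "inner (A x) (\<i> *\<^sub>C A y) = inner x (\<i> *\<^sub>C y)"
    using inner[of "\<i> *\<^sub>C y"] isometry_on_scaleC[OF A y, of \<i>] complex_vector.subspace_scale[OF S y]
    by simp
  with inner[OF y] show ?thesis by (simp add: complex_eq_iff Re_cinner Im_cinner)
qed

lemma isometry_on_continuous:
  assumes A: "isometry_on S T A" and S: "csubspace S"
  shows "continuous_on S A"
proof (rule continuous_onI)
  fix x e assume "x \<in> S" "(0::real) < e"
  then show "\<exists>d>0. \<forall>y\<in>S. dist y x < d \<longrightarrow> dist (A y) (A x) \<le> e"
    using isometry_on_norm[OF A] complex_vector.subspace_diff[OF S]
    by (intro exI[of _ e]) (auto simp: dist_norm simp flip: isometry_on_diff[OF A S])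
qed

lemma isometry_on_image_closed:
  assumes A: "isometry_on S T A" and S: "closed_csubspace S"
  shows "closed_csubspace (A ` S)"
proof -
  note SD = closed_csubspaceD[OF S]
  have "csubspace (A ` S)"
  proof (rule complex_vector.subspaceI)
    show "0 \<in> A ` S" using imageI[OF SD(3), of A] isometry_on_zero[OF A SD(1)] by simp
  next
    fix u v assume "u \<in> A ` S" "v \<in> A ` S"
    then obtain x y where "x \<in> S" "u = A x" "y \<in> S" "v = A y" by blast
    then show "u + v \<in> A ` S"
      using isometry_on_add[OF A, of x y] SD(4)[of x y] by (metis imageI)
  next
    fix u c assume "u \<in> A ` S"
    then obtain x where "x \<in> S" "u = A x" by blast
    then show "c *\<^sub>C u \<in> A ` S"
      using isometry_on_scaleC[OF A, of x c] SD(6)[of x c] by (metis imageI)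
  qed
  moreover have "closed (A ` S)"
    unfolding closed_sequential_limits
  proof (intro allI impI; elim conjE)
    fix b l assume b: "\<forall>n. b n \<in> A ` S" and l: "b \<longlonglongrightarrow> l"
    then have "\<forall>n. \<exists>x. x \<in> S \<and> b n = A x" by blast
    then obtain a where a: "\<And>n. a n \<in> S" "\<And>n. b n = A (a n)" by metis
    have "dist (a m) (a n) = dist (b m) (b n)" for m n
      unfolding a(2) dist_norm isometry_on_diff[OF A SD(1) a(1) a(1), symmetric]
      by (rule isometry_on_norm[OF A SD(5)[OF a(1) a(1), of m n], symmetric])
    then have "Cauchy a" using LIMSEQ_imp_Cauchy[OF l] by (simp add: Cauchy_def)
    then obtain x where x: "a \<longlonglongrightarrow> x" by (auto simp: Cauchy_convergent_iff convergent_def)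
    then have xS: "x \<in> S" using SD(2) a(1) closed_sequentially by blast
    have "(\<lambda>n. A (a n)) \<longlonglongrightarrow> A x"
      using continuous_on_tendsto_compose[OF isometry_on_continuous[OF A SD(1)] x xS] a(1) by simp
    then show "l \<in> A ` S" using l xS LIMSEQ_unique unfolding a(2) by blast
  qed
  ultimately show ?thesis by (simp add: closed_csubspace_def)
qed

lemma adj_on_eqI:
  assumes "csubspace S" "x \<in> S" "\<And>s. s \<in> S \<Longrightarrow> cinner (A s) y = cinner s x"
  shows "adj_on S A y = x"
  unfolding adj_on_def
proof (rule the_equality)
  show "x' = x" if "x' \<in> S \<and> (\<forall>s\<in>S. cinner (A s) y = cinner s x')" for x'
    using cinner_eqI[of x' S x] assms that by auto
qed (use assms in auto)

text \<open>The image of \<open>S\<close> is complete, hence closed; the preimage of the projection of \<open>y\<close> to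
  this image is the value of the adjoint at \<open>y\<close>.\<close>

lemma adj_on_isometry:
  assumes A: "isometry_on S T A" and S: "closed_csubspace S"
  shows "adj_on S A y \<in> S" and "s \<in> S \<Longrightarrow> cinner (A s) y = cinner s (adj_on S A y)"
proof -
  note SD = closed_csubspaceD[OF S]
  obtain p where p: "p \<in> A ` S" "\<And>s. s \<in> A ` S \<Longrightarrow> cinner s (y - p) = 0"
    using orthogonal_decomposition[OF isometry_on_image_closed[OF A S], of y] by blast
  then obtain x where x: "x \<in> S" "p = A x" by blast
  have eq: "cinner (A s) y = cinner s x" if "s \<in> S" for s
  proof -
    have "cinner (A s) y = cinner (A s) p" using p(2)[of "A s"] that by (simp add: cinner_diff_right)
    also have "\<dots> = cinner s x" unfolding x(2) by (rule isometry_on_cinner[OF A SD(1) that x(1)])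
    finally show ?thesis .
  qed
  have "adj_on S A y = x" using SD(1) x(1) eq by (rule adj_on_eqI)
  then show "adj_on S A y \<in> S" and "s \<in> S \<Longrightarrow> cinner (A s) y = cinner s (adj_on S A y)"
    using x eq by simp_all
qed

lemma adj_on_isometry_left_inverse:
  assumes A: "isometry_on S S A" and S: "closed_csubspace S" and x: "x \<in> S"
  shows "adj_on S A (A x) = x"
  by (rule adj_on_eqI[OF closed_csubspaceD(1)[OF S] x
        isometry_on_cinner[OF A closed_csubspaceD(1)[OF S] _ x]])

text \<open>\<open>A A\<^sup>*\<close> is the projection to the range of \<open>A\<close>, and a projection preserves the norm only of
  the vectors in its range.\<close>

lemma isometry_adj_norm_eq:
  assumes A: "isometry_on S S A" and S: "closed_csubspace S" and y: "y \<in> S"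
    and n: "norm (adj_on S A y) = norm y"
  shows "A (adj_on S A y) = y"
proof -
  let ?x = "adj_on S A y"
  have x: "?x \<in> S" by (rule adj_on_isometry(1)[OF A S])
  have "cinner (A ?x) y = of_real ((norm y)\<^sup>2)"
    using adj_on_isometry(2)[OF A S x, of y] n by (simp add: cinner_self)
  then have "inner (A ?x) y = (norm y)\<^sup>2" by (metis Re_cinner Re_complex_of_real)
  moreover have "(norm (A ?x))\<^sup>2 = (norm y)\<^sup>2" using isometry_on_norm[OF A x] n by simp
  ultimately have "(norm (A ?x - y))\<^sup>2 = 0"
    by (simp add: power2_norm_eq_inner inner_simps inner_commute)
  then show ?thesis by simp
qed

section \<open>The universal property of minimal isometric dilations\<close>

lemma adj_on_bounded_linear:
  assumes A: "isometry_on S T A" and S: "closed_csubspace S"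
  shows "bounded_linear (adj_on S A)" and "adj_on S A (c *\<^sub>C y) = c *\<^sub>C adj_on S A y"
proof -
  note SD = closed_csubspaceD[OF S] and adj = adj_on_isometry[OF A S]
  show C: "adj_on S A (c *\<^sub>C y) = c *\<^sub>C adj_on S A y" for c y
    by (rule adj_on_eqI) (simp_all add: SD adj cinner_scaleC_right)
  show "bounded_linear (adj_on S A)"
  proof
    show "adj_on S A (x + y) = adj_on S A x + adj_on S A y" for x y
      by (rule adj_on_eqI) (simp_all add: SD adj cinner_add_right)
    show "adj_on S A (r *\<^sub>R x) = r *\<^sub>R adj_on S A x" for r x
      by (simp add: scaleR_scaleC C)
    have "norm (adj_on S A y) \<le> norm y * 1" for y
    proof -
      let ?x = "adj_on S A y"
      have "complex_of_real ((norm ?x)\<^sup>2) = cinner (A ?x) y"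
        using adj(2)[OF adj(1), of y y] by (simp add: cinner_self)
      then have "(norm ?x)\<^sup>2 = cmod (cinner (A ?x) y)"
        by (metis abs_power2 norm_of_real)
      also have "\<dots> \<le> norm ?x * norm y"
        using norm_cinner_le[of "A ?x" y] isometry_on_norm[OF A adj(1)] by simp
      finally show ?thesis by (cases "?x = 0") (simp_all add: power2_eq_square)
    qed
    then show "\<exists>K. \<forall>x. norm (adj_on S A x) \<le> norm x * K" by blast
  qed
qed

lemma isometric_dilationD:
  assumes "isometric_dilation K V \<pi> P"
  shows "isometry_on K K V" "isometry_on UNIV K \<pi>" "\<pi> (adj P h) = adj_on K V (\<pi> h)" "\<pi> h \<in> K"
  using assms isometry_on_mem[of UNIV K \<pi> h] by (simp_all add: isometric_dilation_def)

lemma isometry_on_funpow: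
  assumes "isometry_on K K V" "x \<in> K"
  shows "(V ^^ m) x \<in> K"
  using assms isometry_on_mem by (induction m) auto

text \<open>The inner products of the vectors \<open>V\<^sup>m \<pi> h\<close> are determined by \<open>P\<close>. An
  isometry that matches these vectors for two dilations of \<open>P\<close> is therefore well defined.\<close>

lemma dilation_cinner:
  assumes d: "isometric_dilation K V \<pi> P" and K: "closed_csubspace K"
  shows "cinner ((V ^^ m) (\<pi> h)) ((V ^^ n) (\<pi> k)) =
    (if n \<le> m then cinner h ((adj P ^^ (m - n)) k) else cnj (cinner k ((adj P ^^ (n - m)) h)))"
proof -
  note D = isometric_dilationD[OF d] and KD = closed_csubspaceD[OF K]
  have power: "cinner ((V ^^ i) (\<pi> h)) (\<pi> k) = cinner h ((adj P ^^ i) k)" for i h k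
  proof (induction i arbitrary: k)
    case 0
    show ?case
      using isometry_on_cinner[OF D(2) complex_vector.subspace_UNIV] by simp
  next
    case (Suc i)
    have "cinner ((V ^^ Suc i) (\<pi> h)) (\<pi> k) = cinner ((V ^^ i) (\<pi> h)) (\<pi> (adj P k))"
      unfolding D(3)
      using adj_on_isometry(2)[OF D(1) K isometry_on_funpow[OF D(1) D(4)]] by simp
    with Suc.IH show ?case by (simp add: funpow_swap1)
  qed
  have cancel: "cinner ((V ^^ (n + i)) (\<pi> h)) ((V ^^ n) (\<pi> k)) = cinner ((V ^^ i) (\<pi> h)) (\<pi> k)"
    for n i h k
  proof (induction n)
    case (Suc n)
    then show ?case
      using isometry_on_cinner[OF D(1) KD(1)] isometry_on_funpow[OF D(1) D(4)] by simp
  qed simp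
  show ?thesis
  proof (cases "n \<le> m")
    case True
    then show ?thesis using cancel[of n "m - n" h k] power by simp
  next
    case False
    then show ?thesis
      using cancel[of m "n - m" k h] power cinner_commute[of "(V ^^ m) (\<pi> h)"] by simp
  qed
qed

lemma closure_cspan_subset:
  assumes "G \<subseteq> T" "closed_csubspace T"
  shows "closure (cspan G) \<subseteq> T"
  using assms unfolding closed_csubspace_def
  by (intro closure_minimal complex_vector.span_minimal) auto

lemma closed_csubspace_minimal_dilation:
  "minimal_dilation K V \<pi> \<Longrightarrow> closed_csubspace K"
  unfolding minimal_dilation_def by (metis closed_csubspace_closure complex_vector.subspace_span)

lemma closed_csubspace_cinner_eq:
  "closed_csubspace {p. cinner (fst p) (fst q) = cinner (snd p) (snd q)}"
  for q :: "'a::chilbert \<times> 'b::chilbert"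
  unfolding closed_csubspace_def
proof
  show "closed {p. cinner (fst p) (fst q) = cinner (snd p) (snd q)}"
    by (intro closed_Collect_eq linear_continuous_on bounded_linear_compose[OF bounded_linear_cinner_left]
        bounded_linear_fst bounded_linear_snd)
  show "csubspace {p. cinner (fst p) (fst q) = cinner (snd p) (snd q)}"
    by (rule complex_vector.subspaceI) (auto simp: cinner_add_left scaleC_prod_def cinner_scaleC_left)
qed

text \<open>The factoring isometry is defined by its graph: the closed span \<open>\<Gamma>\<close> of the pairs
  \<open>(S\<^sup>m \<rho> h, V\<^sup>m \<pi> h)\<close>. Both components have the same inner products, so \<open>\<Gamma>\<close> is the
  graph of an isometry; its domain is complete and contains the dense span of the \<open>S\<^sup>m \<rho> h\<close>.
  The graph is invariant under \<open>S\<^sup>* \<times> V\<^sup>*\<close> because both adjoints act in the same way on the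
  generators: they lower \<open>m\<close> or, for \<open>m = 0\<close>, replace \<open>h\<close> by \<open>P\<^sup>* h\<close>.\<close>

lemma dilation_factor_exists:
  fixes S :: "'a::chilbert \<Rightarrow> 'a" and V :: "'k::chilbert \<Rightarrow> 'k"
    and \<rho> :: "'h::chilbert \<Rightarrow> 'a" and \<pi> :: "'h \<Rightarrow> 'k"
  assumes dS: "isometric_dilation K S \<rho> P" and min: "minimal_dilation K S \<rho>"
    and dV: "isometric_dilation UNIV V \<pi> P"
  obtains \<Phi> where "\<Phi> \<in> extensional K" "isometry_on K UNIV \<Phi>" "\<And>h. \<Phi> (\<rho> h) = \<pi> h"
    "\<And>x. x \<in> K \<Longrightarrow> \<Phi> (adj_on K S x) = adj V (\<Phi> x)"
proof -
  note K = closed_csubspace_minimal_dilation[OF min]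
  note KD = closed_csubspaceD[OF K]
  note S = isometric_dilationD[OF dS] and V = isometric_dilationD[OF dV]
  define G where "G = {((S ^^ m) (\<rho> h), (V ^^ m) (\<pi> h)) | m h. True}"
  have gen: "((S ^^ m) (\<rho> h), (V ^^ m) (\<pi> h)) \<in> G" for m h unfolding G_def by blast
  define \<Gamma> where "\<Gamma> = closure (cspan G)"
  have \<Gamma>: "closed_csubspace \<Gamma>"
    unfolding \<Gamma>_def by (intro closed_csubspace_closure complex_vector.subspace_span)
  note \<Gamma>D = closed_csubspaceD[OF \<Gamma>]
  have span\<Gamma>: "cspan G \<subseteq> \<Gamma>" unfolding \<Gamma>_def by (rule closure_subset)
  have G\<Gamma>: "G \<subseteq> \<Gamma>" using span\<Gamma> complex_vector.span_superset by blast
  have GG: "cinner (fst p) (fst q) = cinner (snd p) (snd q)" if "p \<in> G" "q \<in> G" for p q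
    using that by (auto simp: G_def dilation_cinner[OF dS K] dilation_cinner[OF dV closed_csubspace_UNIV])
  have extend: "cinner (fst p) (fst q) = cinner (snd p) (snd q)"
    if "\<And>r. r \<in> G \<Longrightarrow> cinner (fst r) (fst q) = cinner (snd r) (snd q)" "p \<in> \<Gamma>" for p q
  proof -
    have "G \<subseteq> {p. cinner (fst p) (fst q) = cinner (snd p) (snd q)}" using that(1) by blast
    from closure_cspan_subset[OF this closed_csubspace_cinner_eq] show ?thesis
      using that(2) unfolding \<Gamma>_def by blast
  qed
  have flip: "cinner (fst q) (fst p) = cinner (snd q) (snd p)"
    if "cinner (fst p) (fst q) = cinner (snd p) (snd q)" for p q :: "'a \<times> 'k"
    using that cinner_commute[of "fst q"] cinner_commute[of "snd q"] by simp
  have \<Gamma>\<Gamma>: "cinner (fst p) (fst q) = cinner (snd p) (snd q)" if "p \<in> \<Gamma>" "q \<in> \<Gamma>" for p q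
  proof -
    have "cinner (fst q) (fst r) = cinner (snd q) (snd r)" if "r \<in> G" for r
      using extend[OF GG[OF _ that] \<open>q \<in> \<Gamma>\<close>] .
    then show ?thesis using extend[OF flip \<open>p \<in> \<Gamma>\<close>] by blast
  qed
  have norm_eq: "norm y = norm x" if "(x, y) \<in> \<Gamma>" for x y
  proof -
    have "complex_of_real ((norm x)\<^sup>2) = complex_of_real ((norm y)\<^sup>2)"
      using \<Gamma>\<Gamma>[OF that that] by (simp add: cinner_self)
    then have "(norm x)\<^sup>2 = (norm y)\<^sup>2" by (simp only: of_real_eq_iff)
    then show ?thesis by simp
  qed
  have func: "y = y'" if "(x, y) \<in> \<Gamma>" "(x, y') \<in> \<Gamma>" for x y y'
    using norm_eq[of 0 "y - y'"] \<Gamma>D(5)[OF that] by simp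
  have dom: "\<exists>y. (x, y) \<in> \<Gamma>" if "x \<in> K" for x
  proof -
    define D where "D = {x. \<exists>y. (x, y) \<in> cspan G}"
    have "csubspace D"
    proof (rule complex_vector.subspaceI)
      have "(0, 0) \<in> cspan G" using complex_vector.span_zero[of G] by (simp add: zero_prod_def)
      then show "0 \<in> D" unfolding D_def by blast
    next
      fix x x' assume "x \<in> D" "x' \<in> D"
      then obtain y y' where "(x, y) \<in> cspan G" "(x', y') \<in> cspan G" unfolding D_def by blast
      from complex_vector.span_add[OF this] show "x + x' \<in> D" unfolding D_def by auto
    next
      fix c x assume "x \<in> D"
      then obtain y where "(x, y) \<in> cspan G" unfolding D_def by blast
      from complex_vector.span_scale[OF this, of c] show "c *\<^sub>C x \<in> D"
        unfolding D_def by (auto simp: scaleC_prod_def)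
    qed
    moreover have "{(S ^^ m) (\<rho> h) | m h. True} \<subseteq> D"
      using complex_vector.span_superset[of G] unfolding D_def G_def by blast
    ultimately have span: "cspan {(S ^^ m) (\<rho> h) | m h. True} \<subseteq> D"
      by (intro complex_vector.span_minimal)
    from \<open>x \<in> K\<close> have "x \<in> closure (cspan {(S ^^ m) (\<rho> h) | m h. True})"
      using min unfolding minimal_dilation_def by simp
    then obtain a where a: "\<And>n. a n \<in> cspan {(S ^^ m) (\<rho> h) | m h. True}" "a \<longlonglongrightarrow> x"
      unfolding closure_sequential by blast
    have "\<forall>n. \<exists>y. (a n, y) \<in> \<Gamma>" using subsetD[OF span a(1)] span\<Gamma> unfolding D_def by blast
    then obtain b where b: "\<And>n. (a n, b n) \<in> \<Gamma>" by metis
    have "dist (b m) (b n) = dist (a m) (a n)" for m n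
      using norm_eq[of "a m - a n" "b m - b n"] \<Gamma>D(5)[OF b b, of m n] by (simp add: dist_norm)
    then have "Cauchy b" using LIMSEQ_imp_Cauchy[OF a(2)] by (simp add: Cauchy_def)
    then obtain y where y: "b \<longlonglongrightarrow> y" by (auto simp: Cauchy_convergent_iff convergent_def)
    have "(x, y) \<in> \<Gamma>"
      using closed_sequentially[OF \<Gamma>D(2) b tendsto_Pair[OF a(2) y]] .
    then show ?thesis ..
  qed
  define \<Phi> where "\<Phi> = restrict (\<lambda>x. THE y. (x, y) \<in> \<Gamma>) K"
  have \<Phi>: "\<Phi> x = y" if "x \<in> K" "(x, y) \<in> \<Gamma>" for x y
    using that func by (auto simp: \<Phi>_def)
  have graph: "(x, \<Phi> x) \<in> \<Gamma>" if "x \<in> K" for x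
    using dom[OF that] \<Phi>[OF that] by auto
  have inter: "(adj_on K S x, adj V y) \<in> \<Gamma>" if "(x, y) \<in> \<Gamma>" for x y
  proof -
    define T where "T = (\<lambda>p. (adj_on K S (fst p), adj V (snd p))) -` \<Gamma>"
    note bS = adj_on_bounded_linear[OF S(1) K] and bV = adj_on_bounded_linear[OF V(1) closed_csubspace_UNIV]
    have "closed T"
      unfolding T_def
      by (intro closed_vimage \<Gamma>D continuous_on_Pair
          linear_continuous_on bounded_linear_compose[OF bS(1)] bounded_linear_compose[OF bV(1)]
          bounded_linear_fst bounded_linear_snd)
    moreover have "csubspace T"
    proof (rule complex_vector.subspaceI)
      show "0 \<in> T"
        using \<Gamma>D(3) linear_0[OF bounded_linear.linear[OF bS(1)]] linear_0[OF bounded_linear.linear[OF bV(1)]]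
        by (simp add: T_def zero_prod_def)
      show "p + q \<in> T" if "p \<in> T" "q \<in> T" for p q
        using \<Gamma>D(4)[OF that[unfolded T_def vimage_eq]]
        by (simp add: T_def linear_add[OF bounded_linear.linear[OF bS(1)]] linear_add[OF bounded_linear.linear[OF bV(1)]])
      show "c *\<^sub>C p \<in> T" if "p \<in> T" for c p
        using \<Gamma>D(6)[OF that[unfolded T_def vimage_eq], of c] by (simp add: T_def scaleC_prod_def bS(2) bV(2))
    qed
    moreover have "G \<subseteq> T"
    proof
      fix p assume "p \<in> G"
      then obtain m h where p: "p = ((S ^^ m) (\<rho> h), (V ^^ m) (\<pi> h))" by (auto simp: G_def)
      have "(adj_on K S (fst p), adj V (snd p)) \<in> G"
      proof (cases m)
        case 0
        then show ?thesis
          using p gen[of 0 "adj P h"] by (simp add: S(3) V(3))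
      next
        case (Suc i)
        then show ?thesis
          using p gen[of i h] isometry_on_funpow[OF S(1) S(4)]
          by (simp add: adj_on_isometry_left_inverse[OF S(1) K]
              adj_on_isometry_left_inverse[OF V(1) closed_csubspace_UNIV])
      qed
      then show "p \<in> T" using G\<Gamma> by (auto simp: T_def)
    qed
    ultimately have "\<Gamma> \<subseteq> T"
      unfolding \<Gamma>_def by (intro closure_cspan_subset) (simp_all add: closed_csubspace_def)
    from subsetD[OF this that] show ?thesis by (simp add: T_def)
  qed
  show ?thesis
  proof
    show "\<Phi> \<in> extensional K" by (simp add: \<Phi>_def)
    show "isometry_on K UNIV \<Phi>"
      unfolding isometry_on_def clinear_on_def
    proof (intro conjI ballI allI)
      show "\<Phi> (x + y) = \<Phi> x + \<Phi> y" if "x \<in> K" "y \<in> K" for x y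
        using \<Gamma>D(4)[OF graph graph, OF that] KD(4)[OF that] by (simp add: \<Phi>)
      show "\<Phi> (c *\<^sub>C x) = c *\<^sub>C \<Phi> x" if "x \<in> K" for c x
        using \<Gamma>D(6)[OF graph, OF that, of c] KD(6)[OF that] by (simp add: \<Phi> scaleC_prod_def)
      show "norm (\<Phi> x) = norm x" if "x \<in> K" for x
        using graph[OF that] by (rule norm_eq)
    qed simp
    show "\<Phi> (\<rho> h) = \<pi> h" for h
    proof (rule \<Phi>[OF S(4)])
      show "(\<rho> h, \<pi> h) \<in> \<Gamma>" using subsetD[OF G\<Gamma> gen[of 0 h]] by simp
    qed
    show "\<Phi> (adj_on K S x) = adj V (\<Phi> x)" if "x \<in> K" for x
      using adj_on_isometry(1)[OF S(1) K] inter[OF graph[OF that]] by (rule \<Phi>)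
  qed
qed

text \<open>If \<open>\<Phi>\<close> intertwines the adjoints, then \<open>V\<^sup>* \<Phi> S = \<Phi> S\<^sup>* S = \<Phi>\<close>, so \<open>V\<^sup>*\<close> preserves the
  norm of \<open>\<Phi> S x\<close>. Hence \<open>\<Phi> S x\<close> lies in the range of \<open>V\<close>, and \<open>\<Phi> S x = V V\<^sup>* \<Phi> S x = V \<Phi> x\<close>.
  This turns the relation for the adjoints into one that propagates along the vectors
  \<open>S\<^sup>m \<rho> h\<close>.\<close>

lemma adj_intertwiner_intertwines:
  assumes S: "isometry_on K K S" and K: "closed_csubspace K" and V: "isometry_on UNIV UNIV V"
    and \<Phi>: "isometry_on K UNIV \<Phi>" and adj: "\<And>x. x \<in> K \<Longrightarrow> \<Phi> (adj_on K S x) = adj V (\<Phi> x)"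
    and x: "x \<in> K"
  shows "\<Phi> (S x) = V (\<Phi> x)"
proof -
  have Sx: "S x \<in> K" using S x by (rule isometry_on_mem)
  have eq: "adj V (\<Phi> (S x)) = \<Phi> x"
    using adj[OF Sx] adj_on_isometry_left_inverse[OF S K x] by simp
  then have "norm (adj V (\<Phi> (S x))) = norm (\<Phi> (S x))"
    using isometry_on_norm[OF \<Phi>] isometry_on_norm[OF S] x Sx by simp
  from isometry_adj_norm_eq[OF V closed_csubspace_UNIV UNIV_I this] show ?thesis
    by (simp add: eq)
qed

lemma dilation_factor_unique:
  assumes dS: "isometric_dilation K S \<rho> P" and min: "minimal_dilation K S \<rho>"
    and \<Phi>: "isometry_on K UNIV \<Phi>" "\<And>x. x \<in> K \<Longrightarrow> \<Phi> (S x) = V (\<Phi> x)"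
    and \<Psi>: "isometry_on K UNIV \<Psi>" "\<And>x. x \<in> K \<Longrightarrow> \<Psi> (S x) = V (\<Psi> x)"
    and eq: "\<And>h. \<Phi> (\<rho> h) = \<Psi> (\<rho> h)" and x: "x \<in> K"
  shows "\<Phi> x = \<Psi> x"
proof -
  note K = closed_csubspace_minimal_dilation[OF min]
  note KD = closed_csubspaceD[OF K] and S = isometric_dilationD[OF dS]
  define T where "T = {x \<in> K. \<Phi> x - \<Psi> x = 0}"
  have "closed T"
    unfolding T_def using \<Phi>(1) \<Psi>(1) KD
    by (intro continuous_closed_preimage_constant continuous_on_diff isometry_on_continuous)
  moreover have "csubspace T"
    using isometry_on_zero[OF \<Phi>(1) KD(1)] isometry_on_zero[OF \<Psi>(1) KD(1)] KD(3,4,6)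
    by (intro complex_vector.subspaceI)
      (simp_all add: T_def isometry_on_add[OF \<Phi>(1)] isometry_on_add[OF \<Psi>(1)]
        isometry_on_scaleC[OF \<Phi>(1)] isometry_on_scaleC[OF \<Psi>(1)])
  moreover have "(S ^^ m) (\<rho> h) \<in> T" for m h
  proof -
    have "\<Phi> ((S ^^ m) (\<rho> h)) = \<Psi> ((S ^^ m) (\<rho> h))"
      using eq \<Phi>(2) \<Psi>(2) isometry_on_funpow[OF S(1) S(4)] by (induction m) simp_all
    then show ?thesis using isometry_on_funpow[OF S(1) S(4)] by (simp add: T_def)
  qed
  then have "{(S ^^ m) (\<rho> h) | m h. True} \<subseteq> T" by blast
  ultimately have "K \<subseteq> T"
    using closure_cspan_subset[of _ T] min unfolding minimal_dilation_def closed_csubspace_def by blast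
  then show ?thesis using x by (auto simp: T_def)
qed

section \<open>Coefficients in the vector-valued Hardy space\<close>

definition h2_const :: "'a::chilbert \<Rightarrow> 'a h2" where
  "h2_const \<eta> = Abs_h2 (disc_series (case_nat \<eta> (\<lambda>_. 0)))"

definition h2_backshift :: "'a::chilbert h2 \<Rightarrow> 'a h2" where
  "h2_backshift f = Abs_h2 (disc_series (\<lambda>n. h2_coeff f (Suc n)))"

lemma square_summable_case_nat: "square_summable a \<Longrightarrow> square_summable (case_nat x a)"
  unfolding square_summable_def by (subst summable_Suc_iff[symmetric]) simp

lemma square_summable_Suc: "square_summable a \<Longrightarrow> square_summable (\<lambda>n. a (Suc n))"
  unfolding square_summable_def by (subst summable_Suc_iff)

lemma h2_coeff_const: "h2_coeff (h2_const \<eta>) = case_nat \<eta> (\<lambda>_. 0)"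
  unfolding h2_const_def by (simp add: square_summable_case_nat)

lemma h2_coeff_backshift: "h2_coeff (h2_backshift f) n = h2_coeff f (Suc n)"
  unfolding h2_backshift_def by (simp add: square_summable_Suc)

lemma h2_coeff_mult_z: "h2_coeff (mult_z f) = case_nat 0 (h2_coeff f)"
proof -
  let ?a = "case_nat 0 (h2_coeff f)"
  have a: "square_summable ?a" by (simp add: square_summable_case_nat)
  have "disc_series (h2_coeff (mult_z f)) z = disc_series ?a z" for z
  proof (cases "cmod z < 1")
    case True
    have "(\<lambda>n. z *\<^sub>C z ^ n *\<^sub>C h2_coeff f n) sums (z *\<^sub>C h2_fun f z)"
      by (intro bounded_linear.sums[OF bounded_bilinear.bounded_linear_right[OF
            bounded_bilinear_scaleC]] h2_fun_sums True)
    then have "(\<lambda>n. z ^ Suc n *\<^sub>C ?a (Suc n)) sums (z *\<^sub>C h2_fun f z)"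
      by (simp add: scaleC_scaleC)
    then have "(\<lambda>n. z ^ n *\<^sub>C ?a n) sums h2_fun (mult_z f) z"
      by (subst (asm) sums_Suc_iff) (simp add: h2_fun_mult_z)
    then show ?thesis
      unfolding h2_fun_coeff[symmetric] using True by (simp add: disc_series_def sums_unique)
  qed (simp add: disc_series_def)
  then show ?thesis by (intro disc_series_inject[OF square_summable_coeff a]) (rule ext)
qed

lemma h2_const_plus_backshift: "f = h2_const (h2_coeff f 0) + mult_z (h2_backshift f)"
  unfolding h2_eq_iff
  by (rule ext)
    (simp add: h2_coeff_ops h2_coeff_const h2_coeff_mult_z h2_coeff_backshift split: nat.split)

lemma h2_fun_const:
  assumes "cmod z < 1"
  shows "h2_fun (h2_const \<eta>) z = \<eta>"
proof -
  have "(\<lambda>n. z ^ n *\<^sub>C h2_coeff (h2_const \<eta>) n) sums \<eta>"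
    using sums_finite[of "{0}" "\<lambda>n. z ^ n *\<^sub>C h2_coeff (h2_const \<eta>) n"]
    by (simp add: h2_coeff_const split: nat.split)
  with h2_fun_sums[OF assms] show ?thesis by (rule sums_unique2)
qed

lemma h2_const_mem_h2_on_iff: "h2_const \<eta> \<in> h2_on E \<longleftrightarrow> \<eta> \<in> E"
proof -
  have "h2_fun (h2_const \<eta>) z = \<eta>" if "z \<in> ball 0 1" for z
    using that by (intro h2_fun_const) simp
  then have "h2_const \<eta> \<in> h2_on E \<longleftrightarrow> (\<forall>z\<in>ball (0::complex) 1. \<eta> \<in> E)"
    by (simp only: h2_on_def mem_Collect_eq cong: ball_cong)
  then show ?thesis by (metis centre_in_ball zero_less_one)
qed

lemma h2_const_add: "h2_const (\<eta> + \<xi>) = h2_const \<eta> + h2_const \<xi>"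
  and h2_const_scaleC: "h2_const (c *\<^sub>C \<eta>) = c *\<^sub>C h2_const \<eta>"
  unfolding h2_eq_iff
  by (auto simp: fun_eq_iff h2_coeff_ops h2_coeff_scaleC h2_coeff_const split: nat.split)

lemma h2_norm_eqI:
  assumes "\<And>n. norm (h2_coeff f n) = norm (h2_coeff g n)"
  shows "norm f = norm g"
proof -
  have "(norm f)\<^sup>2 = (norm g)\<^sup>2"
    using h2_norm_sums[of f] h2_norm_sums[of g] unfolding assms by (rule sums_unique2)
  then show ?thesis by simp
qed

lemma norm_h2_const: "norm (h2_const \<eta>) = norm \<eta>"
proof -
  have "(\<lambda>n. (norm (h2_coeff (h2_const \<eta>) n))\<^sup>2) sums (norm \<eta>)\<^sup>2"
    using sums_finite[of "{0}" "\<lambda>n. (norm (h2_coeff (h2_const \<eta>) n))\<^sup>2"]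
    by (simp add: h2_coeff_const split: nat.split)
  with h2_norm_sums[of "h2_const \<eta>"] have "(norm (h2_const \<eta>))\<^sup>2 = (norm \<eta>)\<^sup>2"
    by (rule sums_unique2)
  then show ?thesis by simp
qed

lemma cinner_mult_z: "cinner (mult_z f) g = cinner f (h2_backshift g)"
proof -
  have "summable (\<lambda>n. cinner (h2_coeff (mult_z f) n) (h2_coeff g n))"
    by (simp add: square_summable_inner)
  from suminf_split_head[OF this] show ?thesis
    by (simp add: cinner_h2_def h2_coeff_mult_z h2_coeff_backshift)
qed

text \<open>A function with values in a closed subspace has its coefficients there: by uniqueness of
  power series, the coefficients of \<open>\<langle>f(\<cdot>), y\<rangle>\<close> vanish for every \<open>y\<close> orthogonal to the
  subspace.\<close>

lemma h2_on_iff_coeff: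
  assumes E: "closed_csubspace E"
  shows "f \<in> h2_on E \<longleftrightarrow> (\<forall>n. h2_coeff f n \<in> E)"
proof
  assume f: "f \<in> h2_on E"
  show "\<forall>n. h2_coeff f n \<in> E"
  proof (intro allI mem_closed_csubspaceI[OF E])
    fix n y assume y: "\<And>s. s \<in> E \<Longrightarrow> cinner s y = 0"
    let ?a = "\<lambda>n. cinner (h2_coeff f n) y"
    have "summable (\<lambda>n. (norm y)\<^sup>2 * (norm (h2_coeff f n))\<^sup>2)"
      using square_summable_coeff[of f] unfolding square_summable_def by (rule summable_mult)
    then have ssq: "square_summable ?a"
      unfolding square_summable_def
    proof (rule summable_comparison_test')
      show "norm ((norm (?a n))\<^sup>2) \<le> (norm y)\<^sup>2 * (norm (h2_coeff f n))\<^sup>2" for n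
        using power_mono[OF norm_cinner_le[of "h2_coeff f n" y] norm_ge_zero, of 2]
        by (simp add: power_mult_distrib mult.commute)
    qed
    have "disc_series ?a z = disc_series (\<lambda>_. 0) z" for z
    proof (cases "cmod z < 1")
      case True
      have "(\<lambda>n. cinner (z ^ n *\<^sub>C h2_coeff f n) y) sums cinner (h2_fun f z) y"
        by (rule bounded_linear.sums[OF bounded_linear_cinner_left h2_fun_sums[OF True]])
      moreover have "cinner (h2_fun f z) y = 0"
        using f True by (intro y) (simp add: h2_on_def)
      ultimately have "(\<lambda>n. z ^ n *\<^sub>C ?a n) sums 0"
        by (simp add: cinner_scaleC_left scaleC_complex_def)
      then show ?thesis by (simp add: disc_series_def sums_unique[symmetric])
    qed (simp add: disc_series_def)
    then have "disc_series ?a = disc_series (\<lambda>_. 0)" by (rule ext)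
    from disc_series_inject[OF ssq square_summable_zero this]
    show "cinner (h2_coeff f n) y = 0" by (simp add: fun_eq_iff)
  qed
next
  assume f: "\<forall>n. h2_coeff f n \<in> E"
  note ED = closed_csubspaceD[OF E]
  have "h2_fun f z \<in> E" if "cmod z < 1" for z
  proof -
    have lim: "(\<lambda>N. \<Sum>n<N. z ^ n *\<^sub>C h2_coeff f n) \<longlonglongrightarrow> h2_fun f z"
      using h2_fun_sums[OF that, of f] by (simp add: sums_def)
    have "(\<Sum>n<N. z ^ n *\<^sub>C h2_coeff f n) \<in> E" for N
      using f ED(6) by (intro complex_vector.subspace_sum[OF ED(1)]) blast
    from closed_sequentially[OF ED(2) this lim] show ?thesis .
  qed
  then show "f \<in> h2_on E" by (simp add: h2_on_def)
qed

text \<open>The adjoint of the shift is the backward shift, whose kernel consists of the constants.\<close>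

lemma h2_const_if_orthogonal_mult_z:
  assumes E: "closed_csubspace E" and g: "g \<in> h2_on E"
    and orth: "\<And>f. f \<in> h2_on E \<Longrightarrow> cinner (mult_z f) g = 0"
  shows "g = h2_const (h2_coeff g 0)"
proof -
  have "h2_backshift g \<in> h2_on E"
    using g by (simp add: h2_on_iff_coeff[OF E] h2_coeff_backshift)
  from orth[OF this] have "h2_backshift g = 0" by (simp add: cinner_mult_z)
  then have "h2_coeff g (Suc n) = 0" for n
    using h2_coeff_backshift[of g n] by (simp add: h2_coeff_zero)
  then show ?thesis
    unfolding h2_eq_iff by (auto simp: fun_eq_iff h2_coeff_const split: nat.split)
qed

lemma isometry_on_sums:
  assumes A: "isometry_on S T A" and S: "closed_csubspace S"
    and a: "\<And>n. a n \<in> S" and sums: "a sums s"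
  shows "(\<lambda>n. A (a n)) sums A s"
proof -
  note SD = closed_csubspaceD[OF S]
  have part: "(\<Sum>n<N. a n) \<in> S" for N
    using a by (intro complex_vector.subspace_sum[OF SD(1)])
  have lim: "(\<lambda>N. \<Sum>n<N. a n) \<longlonglongrightarrow> s" using sums by (simp add: sums_def)
  from closed_sequentially[OF SD(2) part this] have "s \<in> S" .
  then have "(\<lambda>N. A (\<Sum>n<N. a n)) \<longlonglongrightarrow> A s"
    using continuous_on_tendsto_compose[OF isometry_on_continuous[OF A SD(1)] lim] part by simp
  moreover have "A (\<Sum>n<N. a n) = (\<Sum>n<N. A (a n))" for N
  proof (induction N)
    case (Suc N)
    then show ?case using isometry_on_add[OF A part a, of N N] by simp
  qed (simp add: isometry_on_zero[OF A SD(1)])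
  ultimately show ?thesis by (simp add: sums_def)
qed

lemma id_tensor_eqI:
  assumes V: "isometry_on D T V" and D: "closed_csubspace D" and f: "f \<in> h2_on D"
    and g: "\<And>n. h2_coeff g n = V (h2_coeff f n)"
  shows "id_tensor V f = g"
proof -
  note DD = closed_csubspaceD[OF D]
  have fD: "h2_coeff f n \<in> D" for n using f h2_on_iff_coeff[OF D] by blast
  have "V (h2_fun f z) = h2_fun g z" for z
  proof (cases "cmod z < 1")
    case True
    have "(\<lambda>n. V (z ^ n *\<^sub>C h2_coeff f n)) sums V (h2_fun f z)"
      by (rule isometry_on_sums[OF V D _ h2_fun_sums[OF True]]) (intro DD(6) fD)
    then have "(\<lambda>n. z ^ n *\<^sub>C h2_coeff g n) sums V (h2_fun f z)"
      by (simp add: isometry_on_scaleC[OF V fD] g)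
    then show ?thesis using h2_fun_sums[OF True] sums_unique2 by blast
  next
    case False
    then show ?thesis
      using isometry_on_zero[OF V DD(1)] by (simp add: h2_fun_coeff disc_series_def)
  qed
  then have "id_tensor V f = Abs_h2 (h2_fun g)" by (simp add: id_tensor_def)
  then show ?thesis by (simp add: h2_fun_inverse)
qed

section \<open>Isometries between sums of a shift and a unitary\<close>

text \<open>Here \<open>W\<close> stands for the multiplication by \<open>e\<^sup>i\<^sup>t\<close> on the second summand of the model space,
  and \<open>\<Psi>\<close> for \<open>\<Phi>\<close> followed by the Wold identification. The orthogonality assumption puts the
  image of a constant into the kernel of \<open>(M\<^sub>z \<oplus> U)\<^sup>*\<close>, so it is a constant in the first
  summand; this defines \<open>V\<^sub>1\<close>. Writing \<open>f = f(0) + z g\<close> and using the intertwining relation,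
  every coefficient of the first component of \<open>\<Psi>(f \<oplus> 0)\<close> is the image under \<open>V\<^sub>1\<close> of the
  coefficient of \<open>f\<close>. Then this component has the full norm of \<open>f\<close>, so nothing is left for
  the second component. In the other direction, each \<open>k \<in> L\<close> is in the range of every power of
  \<open>W\<close>, so the first component of \<open>\<Psi>(0 \<oplus> k)\<close> is divisible by every power of \<open>z\<close>, hence
  vanishes.\<close>

lemma shift_unitary_intertwiner_decomposes:
  fixes \<Psi> :: "'a::chilbert h2 \<times> 'l::chilbert \<Rightarrow> 'e::chilbert h2 \<times> 'u::chilbert"
  assumes D: "closed_csubspace D" and L: "closed_csubspace L"
    and E: "closed_csubspace E" and U: "unitary_on K\<^sub>u K\<^sub>u U"
    and K\<^sub>u: "closed_csubspace K\<^sub>u"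
    and \<Psi>: "isometry_on (h2_on D \<times> L) (h2_on E \<times> K\<^sub>u) \<Psi>"
    and inter: "\<And>x. x \<in> h2_on D \<times> L \<Longrightarrow> \<Psi> (map_prod mult_z W x) = map_prod mult_z U (\<Psi> x)"
    and orth: "\<And>\<eta> y. \<eta> \<in> D \<Longrightarrow> y \<in> h2_on E \<times> K\<^sub>u \<Longrightarrow>
      cinner (map_prod mult_z U y) (\<Psi> (h2_const \<eta>, 0)) = 0"
    and W0: "W 0 = 0" and surj: "\<And>k. k \<in> L \<Longrightarrow> \<exists>k'\<in>L. W k' = k"
  obtains V\<^sub>1 V\<^sub>2 where "isometry_on D E V\<^sub>1" "isometry_on L K\<^sub>u V\<^sub>2"
    "\<And>x. x \<in> h2_on D \<times> L \<Longrightarrow> \<Psi> x = map_prod (id_tensor V\<^sub>1) V\<^sub>2 x"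
proof -
  note DD = closed_csubspaceD[OF D] and LD = closed_csubspaceD[OF L]
    and ED = closed_csubspaceD[OF E] and KD = closed_csubspaceD[OF K\<^sub>u]
  have U_iso: "isometry_on K\<^sub>u K\<^sub>u U" and U_surj: "U ` K\<^sub>u = K\<^sub>u"
    using U by (simp_all add: unitary_on_def)
  note coeff_D = h2_on_iff_coeff[OF D] and coeff_E = h2_on_iff_coeff[OF E]
  have const_D: "h2_const \<eta> \<in> h2_on D" if "\<eta> \<in> D" for \<eta>
    using that DD(3) by (auto simp: coeff_D h2_coeff_const split: nat.split)
  have back_D: "h2_backshift f \<in> h2_on D" if "f \<in> h2_on D" for f
    using that by (simp add: coeff_D h2_coeff_backshift)
  have shift_D: "mult_z f \<in> h2_on D" if "f \<in> h2_on D" for f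
    using that DD(3) by (auto simp: coeff_D h2_coeff_mult_z split: nat.split)
  have zero_D: "0 \<in> h2_on D" using DD(3) by (simp add: coeff_D h2_coeff_zero)
  have zero_E: "0 \<in> h2_on E" using ED(3) by (simp add: coeff_E h2_coeff_zero)
  have mult_z_0: "mult_z 0 = (0 :: 'c::chilbert h2)"
    unfolding h2_eq_iff by (auto simp: fun_eq_iff h2_coeff_mult_z h2_coeff_zero split: nat.split)
  have \<Psi>_mem: "fst (\<Psi> x) \<in> h2_on E" "snd (\<Psi> x) \<in> K\<^sub>u" if "x \<in> h2_on D \<times> L" for x
    using isometry_on_mem[OF \<Psi> that] by (auto simp: mem_Times_iff)
  define V\<^sub>1 where "V\<^sub>1 \<eta> = h2_coeff (fst (\<Psi> (h2_const \<eta>, 0))) 0" for \<eta>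
  define V\<^sub>2 where "V\<^sub>2 k = snd (\<Psi> (0, k))" for k
  have const: "\<Psi> (h2_const \<eta>, 0) = (h2_const (V\<^sub>1 \<eta>), 0)" if "\<eta> \<in> D" for \<eta>
  proof -
    let ?y = "\<Psi> (h2_const \<eta>, 0)"
    have x: "(h2_const \<eta>, 0) \<in> h2_on D \<times> L" using const_D[OF that] LD(3) by simp
    have "snd ?y \<in> U ` K\<^sub>u" using \<Psi>_mem(2)[OF x] by (simp only: U_surj)
    then obtain v where v: "v \<in> K\<^sub>u" "snd ?y = U v" by blast
    have "cinner (U v) (snd ?y) = 0"
      using orth[OF that, of "(0, v)"] v(1) zero_E by (simp add: cinner_prod_def mult_z_0)
    then have "snd ?y = 0" by (simp add: v(2))
    moreover have "cinner (mult_z f) (fst ?y) = 0" if "f \<in> h2_on E" for f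
      using orth[OF \<open>\<eta> \<in> D\<close>, of "(f, 0)"] that KD(3)
      by (simp add: cinner_prod_def isometry_on_zero[OF U_iso KD(1)])
    with h2_const_if_orthogonal_mult_z[OF E \<Psi>_mem(1)[OF x]]
    have "fst ?y = h2_const (V\<^sub>1 \<eta>)" unfolding V\<^sub>1_def by blast
    ultimately show ?thesis by (simp add: prod_eq_iff)
  qed
  have V\<^sub>1: "isometry_on D E V\<^sub>1"
    unfolding isometry_on_def clinear_on_def
  proof (intro conjI ballI allI Pi_I)
    have cl: "(h2_const \<eta>, 0) \<in> h2_on D \<times> L" if "\<eta> \<in> D" for \<eta>
      using const_D[OF that] LD(3) by simp
    show "V\<^sub>1 \<eta> \<in> E" if "\<eta> \<in> D" for \<eta>
      using \<Psi>_mem(1)[OF cl[OF that]] coeff_E by (simp add: V\<^sub>1_def)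
    show "V\<^sub>1 (\<eta> + \<xi>) = V\<^sub>1 \<eta> + V\<^sub>1 \<xi>" if "\<eta> \<in> D" "\<xi> \<in> D" for \<eta> \<xi>
      using isometry_on_add[OF \<Psi> cl[OF that(1)] cl[OF that(2)]]
      by (simp add: V\<^sub>1_def h2_const_add h2_coeff_ops)
    show "V\<^sub>1 (c *\<^sub>C \<eta>) = c *\<^sub>C V\<^sub>1 \<eta>" if "\<eta> \<in> D" for c \<eta>
      using isometry_on_scaleC[OF \<Psi> cl[OF that], of c]
      by (simp add: V\<^sub>1_def h2_const_scaleC h2_coeff_scaleC scaleC_prod_def)
    show "norm (V\<^sub>1 \<eta>) = norm \<eta>" if "\<eta> \<in> D" for \<eta>
      using isometry_on_norm[OF \<Psi> cl[OF that]] const[OF that]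
      by (simp add: norm_Pair norm_h2_const)
  qed
  have split: "fst (\<Psi> (f, 0)) = h2_const (V\<^sub>1 (h2_coeff f 0)) + mult_z (fst (\<Psi> (h2_backshift f, 0)))"
    if f: "f \<in> h2_on D" for f
  proof -
    have f0: "h2_coeff f 0 \<in> D" using f coeff_D by blast
    have "(f, 0) = (h2_const (h2_coeff f 0), 0) + map_prod mult_z W (h2_backshift f, 0)"
      using h2_const_plus_backshift[of f] by (simp add: W0)
    also have "\<Psi> \<dots> = \<Psi> (h2_const (h2_coeff f 0), 0) + \<Psi> (map_prod mult_z W (h2_backshift f, 0))"
      by (rule isometry_on_add[OF \<Psi>]) (simp_all add: W0 LD(3) const_D f0 shift_D back_D f)
    also have "\<Psi> (map_prod mult_z W (h2_backshift f, 0)) = map_prod mult_z U (\<Psi> (h2_backshift f, 0))"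
      by (rule inter) (simp add: LD(3) back_D f)
    finally show ?thesis by (simp add: const[OF f0])
  qed
  have coeff: "h2_coeff (fst (\<Psi> (f, 0))) n = V\<^sub>1 (h2_coeff f n)" if "f \<in> h2_on D" for f n
    using that
  proof (induction n arbitrary: f)
    case (0 f)
    show ?case by (simp add: split[OF 0] h2_coeff_ops h2_coeff_const h2_coeff_mult_z)
  next
    case (Suc n f)
    show ?case
      using Suc.IH[OF back_D[OF Suc.prems]]
      by (simp add: split[OF Suc.prems] h2_coeff_ops h2_coeff_const h2_coeff_mult_z h2_coeff_backshift)
  qed
  have first: "\<Psi> (f, 0) = (id_tensor V\<^sub>1 f, 0)" if f: "f \<in> h2_on D" for f
  proof -
    have fD: "h2_coeff f n \<in> D" for n using f coeff_D by blast
    have "norm (fst (\<Psi> (f, 0))) = norm f"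
      by (rule h2_norm_eqI) (simp add: coeff[OF f] isometry_on_norm[OF V\<^sub>1 fD])
    moreover have "norm (\<Psi> (f, 0)) = norm f"
      using isometry_on_norm[OF \<Psi>, of "(f, 0)"] f LD(3) by (simp add: norm_Pair)
    then have "(norm (fst (\<Psi> (f, 0))))\<^sup>2 + (norm (snd (\<Psi> (f, 0))))\<^sup>2 = (norm f)\<^sup>2"
      unfolding norm_prod_def by (metis real_sqrt_pow2 sum_power2_ge_zero)
    ultimately have "snd (\<Psi> (f, 0)) = 0" by simp
    with id_tensor_eqI[OF V\<^sub>1 D f coeff[OF f]] show ?thesis by (simp add: prod_eq_iff)
  qed
  have fst0: "h2_coeff (fst (\<Psi> (0, k))) n = 0" if "k \<in> L" for k n
    using that
  proof (induction n arbitrary: k)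
    case (0 k)
    then obtain k' where "k' \<in> L" "W k' = k" using surj by blast
    with inter[of "(0, k')"] show ?case
      by (simp add: zero_D mult_z_0 h2_coeff_mult_z)
  next
    case (Suc n k)
    then obtain k' where "k' \<in> L" "W k' = k" using surj by blast
    with inter[of "(0, k')"] Suc.IH[of k'] show ?case
      by (simp add: zero_D mult_z_0 h2_coeff_mult_z)
  qed
  have second: "\<Psi> (0, k) = (0, V\<^sub>2 k)" if "k \<in> L" for k
    using fst0[OF that] by (simp add: prod_eq_iff V\<^sub>2_def h2_eq_iff fun_eq_iff h2_coeff_zero)
  have V\<^sub>2: "isometry_on L K\<^sub>u V\<^sub>2"
    unfolding isometry_on_def clinear_on_def
  proof (intro conjI ballI allI Pi_I)
    have cl: "(0, k) \<in> h2_on D \<times> L" if "k \<in> L" for k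
      using that zero_D by simp
    show "V\<^sub>2 k \<in> K\<^sub>u" if "k \<in> L" for k
      using \<Psi>_mem(2)[OF cl[OF that]] by (simp add: V\<^sub>2_def)
    show "V\<^sub>2 (k + l) = V\<^sub>2 k + V\<^sub>2 l" if "k \<in> L" "l \<in> L" for k l
      using isometry_on_add[OF \<Psi> cl[OF that(1)] cl[OF that(2)]] by (simp add: V\<^sub>2_def)
    show "V\<^sub>2 (c *\<^sub>C k) = c *\<^sub>C V\<^sub>2 k" if "k \<in> L" for c k
      using isometry_on_scaleC[OF \<Psi> cl[OF that], of c] by (simp add: V\<^sub>2_def scaleC_prod_def)
    show "norm (V\<^sub>2 k) = norm k" if "k \<in> L" for k
      using isometry_on_norm[OF \<Psi> cl[OF that]] second[OF that] by (simp add: norm_Pair)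
  qed
  have "\<Psi> x = map_prod (id_tensor V\<^sub>1) V\<^sub>2 x" if x: "x \<in> h2_on D \<times> L" for x
  proof -
    obtain f k where fk: "x = (f, k)" "f \<in> h2_on D" "k \<in> L" using x by blast
    have "\<Psi> ((f, 0) + (0, k)) = \<Psi> (f, 0) + \<Psi> (0, k)"
      by (rule isometry_on_add[OF \<Psi>]) (simp_all add: fk LD(3) zero_D)
    then show ?thesis by (simp add: fk first second)
  qed
  with V\<^sub>1 V\<^sub>2 show ?thesis by (rule that)
qed

section \<open>Multiplication operators on the range of the defect function\<close>

text \<open>The multiplier \<open>c\<close> is meant to be measurable and essentially bounded; otherwise the product
  may fail to be square integrable and \<^const>\<open>abs_l2\<close> returns an unspecified class.\<close>

definition l2_mult ::
  "(complex \<Rightarrow> complex) \<Rightarrow> 'a::{chilbert, second_countable_topology} l2 \<Rightarrow> 'a l2" where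
  "l2_mult c f = abs_l2 (\<lambda>\<zeta>. c \<zeta> *\<^sub>C rep_l2 f \<zeta>)"

lemma l2_eqI:
  assumes "AE \<zeta> in circle_measure. rep_l2 f \<zeta> = rep_l2 g \<zeta>"
  shows "f = g"
  using Quotient3_rel_rep[OF Quotient3_l2, of f g] assms by simp

lemma rep_l2_add: "AE \<zeta> in circle_measure. rep_l2 (f + g) \<zeta> = rep_l2 f \<zeta> + rep_l2 g \<zeta>"
  using plus_l2.abs_eq[of "rep_l2 f" "rep_l2 g"]
    rep_abs_l2[OF square_integrable_add[OF square_integrable_rep square_integrable_rep], of f g]
  by (simp add: abs_rep_l2)

lemma rep_l2_scaleC: "AE \<zeta> in circle_measure. rep_l2 (c *\<^sub>C f) \<zeta> = c *\<^sub>C rep_l2 f \<zeta>"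
  using scaleC_l2.abs_eq[of "rep_l2 f" c]
    rep_abs_l2[OF square_integrable_scaleC[OF square_integrable_rep, of "\<lambda>_. c" "cmod c" f]]
  by (simp add: abs_rep_l2)

lemma cinner_rep_l2:
  "cinner f g = (LINT \<zeta>|circle_measure. cinner (rep_l2 f \<zeta>) (rep_l2 g \<zeta>))"
  using cinner_l2.abs_eq[of "rep_l2 f" "rep_l2 g"] by (simp add: abs_rep_l2)

lemma mult_eit_eq_l2_mult: "mult_eit f = l2_mult (\<lambda>\<zeta>. \<zeta>) f"
  using mult_eit.abs_eq[of "rep_l2 f"] by (simp add: abs_rep_l2 l2_mult_def)

context
  fixes c :: "complex \<Rightarrow> complex"
  assumes c [measurable]: "c \<in> borel_measurable borel"
    and c_le: "AE \<zeta> in circle_measure. cmod (c \<zeta>) \<le> 1"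
begin

lemma rep_l2_mult: "AE \<zeta> in circle_measure. rep_l2 (l2_mult c f) \<zeta> = c \<zeta> *\<^sub>C rep_l2 f \<zeta>"
  unfolding l2_mult_def
  by (rule rep_abs_l2[OF square_integrable_scaleC[OF square_integrable_rep c c_le]])

lemma cinner_l2_mult:
  "cinner (l2_mult c f) g = (LINT \<zeta>|circle_measure. c \<zeta> * cinner (rep_l2 f \<zeta>) (rep_l2 g \<zeta>))"
  unfolding cinner_rep_l2
proof (rule integral_cong_AE)
  note [measurable] = square_integrable_measurable[OF square_integrable_rep]
  show "(\<lambda>\<zeta>. cinner (rep_l2 (l2_mult c f) \<zeta>) (rep_l2 g \<zeta>)) \<in> borel_measurable circle_measure"
    "(\<lambda>\<zeta>. c \<zeta> * cinner (rep_l2 f \<zeta>) (rep_l2 g \<zeta>)) \<in> borel_measurable circle_measure"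
    by measurable
  show "AE \<zeta> in circle_measure. cinner (rep_l2 (l2_mult c f) \<zeta>) (rep_l2 g \<zeta>)
      = c \<zeta> * cinner (rep_l2 f \<zeta>) (rep_l2 g \<zeta>)"
    using rep_l2_mult[of f] by eventually_elim (simp add: cinner_scaleC_left)
qed

lemma bounded_linear_l2_mult:
  "bounded_linear (l2_mult c :: 'a::{chilbert, second_countable_topology} l2 \<Rightarrow> 'a l2)"
proof
  fix f g :: "'a l2" and r :: real
  show "l2_mult c (f + g) = l2_mult c f + l2_mult c g"
  proof (rule l2_eqI)
    show "AE \<zeta> in circle_measure. rep_l2 (l2_mult c (f + g)) \<zeta> = rep_l2 (l2_mult c f + l2_mult c g) \<zeta>"
      using rep_l2_mult[of "f + g"] rep_l2_mult[of f] rep_l2_mult[of g] rep_l2_add[of f g]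
        rep_l2_add[of "l2_mult c f" "l2_mult c g"]
      by eventually_elim (simp add: scaleC_add_right)
  qed
  show "l2_mult c (r *\<^sub>R f) = r *\<^sub>R l2_mult c f"
    unfolding scaleR_scaleC
  proof (rule l2_eqI)
    show "AE \<zeta> in circle_measure. rep_l2 (l2_mult c (of_real r *\<^sub>C f)) \<zeta>
        = rep_l2 (of_real r *\<^sub>C l2_mult c f) \<zeta>"
      using rep_l2_mult[of "of_real r *\<^sub>C f"] rep_l2_mult[of f] rep_l2_scaleC[of "of_real r" f]
        rep_l2_scaleC[of "of_real r" "l2_mult c f"]
      by eventually_elim (simp add: scaleC_scaleC mult.commute)
  qed
next
  have sq: "(norm f)\<^sup>2 = (LINT \<zeta>|circle_measure. (norm (rep_l2 f \<zeta>))\<^sup>2)" for f :: "'a l2"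
    using inner_l2.abs_eq[of "rep_l2 f" "rep_l2 f"] by (simp add: abs_rep_l2 power2_norm_eq_inner)
  have "norm (l2_mult c f) \<le> norm f * 1" for f :: "'a l2"
  proof -
    have "(norm (l2_mult c f))\<^sup>2 \<le> (norm f)\<^sup>2"
      unfolding sq
    proof (rule integral_mono_AE)
      show "AE \<zeta> in circle_measure. (norm (rep_l2 (l2_mult c f) \<zeta>))\<^sup>2 \<le> (norm (rep_l2 f \<zeta>))\<^sup>2"
        using rep_l2_mult[of f] c_le
        by eventually_elim (simp add: norm_scaleC mult_left_le_one_le power_mono)
    qed (use square_integrable_rep in \<open>unfold square_integrable_def, blast\<close>)+
    from power2_le_imp_le[OF this norm_ge_zero] show ?thesis by simp
  qed
  then show "\<exists>K. \<forall>f :: 'a l2. norm (l2_mult c f) \<le> norm f * K" by blast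
qed

end

lemma indicator_borel:
  assumes "A \<in> sets borel"
  shows "(indicator A :: complex \<Rightarrow> complex) \<in> borel_measurable borel"
    "AE \<zeta> in circle_measure. cmod (indicator A \<zeta>) \<le> 1"
  using assms by (simp_all add: indicator_def)

text \<open>Invariance under cutting to Borel sets implies invariance under all bounded multipliers: if
  \<open>y\<close> is orthogonal to \<open>L\<close>, the integrals of \<open>\<langle>g, y\<rangle>\<close> over all Borel sets vanish, so
  this function is zero almost everywhere and stays so when multiplied by \<open>c\<close>.\<close>

lemma l2_mult_mem_if_indicator:
  fixes L :: "'a::{chilbert, second_countable_topology} l2 set"
  assumes L: "closed_csubspace L"
    and cut: "\<And>A g. A \<in> sets borel \<Longrightarrow> g \<in> L \<Longrightarrow> l2_mult (indicator A) g \<in> L"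
    and c: "c \<in> borel_measurable borel" "AE \<zeta> in circle_measure. cmod (c \<zeta>) \<le> 1"
    and g: "g \<in> L"
  shows "l2_mult c g \<in> L"
proof (rule mem_closed_csubspaceI[OF L])
  fix y assume y: "\<And>s. s \<in> L \<Longrightarrow> cinner s y = 0"
  let ?h = "\<lambda>\<zeta>. cinner (rep_l2 g \<zeta>) (rep_l2 y \<zeta>)"
  have "AE \<zeta> in circle_measure. ?h \<zeta> = 0"
  proof (rule circle_measure.density_zero)
    show "integrable circle_measure ?h" by (simp add: square_integrable_cinner)
    fix A :: "complex set" assume "A \<in> sets circle_measure"
    then have A: "A \<in> sets borel" by simp
    have "(LINT \<zeta>:A|circle_measure. ?h \<zeta>) = cinner (l2_mult (indicator A) g) y"
      unfolding cinner_l2_mult[OF indicator_borel[OF A]] set_lebesgue_integral_def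
      by (rule Bochner_Integration.integral_cong) (auto simp: indicator_def)
    also have "\<dots> = 0" by (rule y[OF cut[OF A g]])
    finally show "(LINT \<zeta>:A|circle_measure. ?h \<zeta>) = 0" .
  qed
  then have "AE \<zeta> in circle_measure. c \<zeta> * ?h \<zeta> = 0" by eventually_elim simp
  then show "cinner (l2_mult c g) y = 0"
    unfolding cinner_l2_mult[OF c] by (rule integral_eq_zero_AE)
qed

text \<open>Membership in the range is a condition at almost every single point, so two members can be
  glued along a Borel set by gluing their preimages.\<close>

lemma Delta_range_glue:
  assumes A: "A \<in> sets borel" and g: "g \<in> Delta_range P" and h: "h \<in> Delta_range P"
  shows "l2_mult (indicator A) g + l2_mult (indicator (- A)) h \<in> Delta_range P"
proof -
  have A': "- A \<in> sets borel" using A by (rule borel_comp)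
  note mA = rep_l2_mult[OF indicator_borel[OF A]] and mA' = rep_l2_mult[OF indicator_borel[OF A']]
  obtain f where f: "AE \<zeta> in circle_measure. rep_l2 f \<zeta> \<in> defect_space P"
      "AE \<zeta> in circle_measure. rep_l2 g \<zeta> = Delta P \<zeta> (rep_l2 f \<zeta>)"
    using g unfolding Delta_range_def l2_on_def by blast
  obtain k where k: "AE \<zeta> in circle_measure. rep_l2 k \<zeta> \<in> defect_space P"
      "AE \<zeta> in circle_measure. rep_l2 h \<zeta> = Delta P \<zeta> (rep_l2 k \<zeta>)"
    using h unfolding Delta_range_def l2_on_def by blast
  let ?f = "l2_mult (indicator A) f + l2_mult (indicator (- A)) k"
  have rep: "AE \<zeta> in circle_measure. rep_l2 (l2_mult (indicator A) u + l2_mult (indicator (- A)) v) \<zeta>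
      = (if \<zeta> \<in> A then rep_l2 u \<zeta> else rep_l2 v \<zeta>)" for u v :: "'a l2"
    using mA[of u] mA'[of v] rep_l2_add[of "l2_mult (indicator A) u" "l2_mult (indicator (- A)) v"]
    by eventually_elim simp
  have "AE \<zeta> in circle_measure. rep_l2 ?f \<zeta> \<in> defect_space P"
    using rep[of f k] f(1) k(1) by eventually_elim simp
  moreover have "AE \<zeta> in circle_measure.
      rep_l2 (l2_mult (indicator A) g + l2_mult (indicator (- A)) h) \<zeta> = Delta P \<zeta> (rep_l2 ?f \<zeta>)"
    using rep[of f k] rep[of g h] f(2) k(2) by eventually_elim simp
  ultimately show ?thesis unfolding Delta_range_def l2_on_def by blast
qed

text \<open>Approximate \<open>g\<close> on \<open>A\<close> and \<open>0\<close> on the complement by members of the range and glue the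
  approximations.\<close>

lemma closure_Delta_range_indicator:
  assumes L: "closed_csubspace (closure (Delta_range P))" and A: "A \<in> sets borel"
    and g: "g \<in> closure (Delta_range P)"
  shows "l2_mult (indicator A) g \<in> closure (Delta_range P)"
proof -
  have A': "- A \<in> sets borel" using A by (rule borel_comp)
  note bA = bounded_linear_l2_mult[OF indicator_borel[OF A]]
    and bA' = bounded_linear_l2_mult[OF indicator_borel[OF A']]
  obtain a where a: "\<And>n. a n \<in> Delta_range P" "a \<longlonglongrightarrow> g"
    using g unfolding closure_sequential by blast
  obtain b where b: "\<And>n. b n \<in> Delta_range P" "b \<longlonglongrightarrow> 0"
    using closed_csubspaceD(3)[OF L] unfolding closure_sequential by blast
  have "(\<lambda>n. l2_mult (indicator A) (a n) + l2_mult (indicator (- A)) (b n))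
      \<longlonglongrightarrow> l2_mult (indicator A) g + l2_mult (indicator (- A)) 0"
    by (intro tendsto_add bounded_linear.tendsto[OF bA a(2)] bounded_linear.tendsto[OF bA' b(2)])
  then have "(\<lambda>n. l2_mult (indicator A) (a n) + l2_mult (indicator (- A)) (b n))
      \<longlonglongrightarrow> l2_mult (indicator A) g"
    by (simp add: linear_0[OF bounded_linear.linear[OF bA']])
  moreover have "l2_mult (indicator A) (a n) + l2_mult (indicator (- A)) (b n) \<in> Delta_range P" for n
    by (rule Delta_range_glue[OF A a(1) b(1)])
  ultimately show ?thesis
    unfolding closure_sequential
    by (intro exI[of _ "\<lambda>n. l2_mult (indicator A) (a n) + l2_mult (indicator (- A)) (b n)"]) simp
qed

text \<open>The inverse of the multiplication by \<open>\<zeta>\<close> on the circle is the multiplication by its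
  conjugate, a bounded measurable multiplier.\<close>

lemma mult_eit_surj_closure_Delta_range:
  assumes L: "closed_csubspace (closure (Delta_range P))" and k: "k \<in> closure (Delta_range P)"
  shows "\<exists>k'\<in>closure (Delta_range P). mult_eit k' = k"
proof
  have le: "AE \<zeta> in circle_measure. cmod \<zeta> \<le> 1"
    using AE_circle_measure by eventually_elim simp
  then have cnj_le: "AE \<zeta> in circle_measure. cmod (cnj \<zeta>) \<le> 1" by simp
  have id: "(\<lambda>\<zeta>::complex. \<zeta>) \<in> borel_measurable borel" by simp
  have cnj: "cnj \<in> borel_measurable borel"
    by (intro borel_measurable_continuous_onI continuous_on_cnj continuous_on_id)
  show "l2_mult cnj k \<in> closure (Delta_range P)"
    by (rule l2_mult_mem_if_indicator[OF L closure_Delta_range_indicator[OF L] cnj cnj_le k])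
  show "mult_eit (l2_mult cnj k) = k"
    unfolding mult_eit_eq_l2_mult
  proof (rule l2_eqI)
    show "AE \<zeta> in circle_measure. rep_l2 (l2_mult (\<lambda>\<zeta>. \<zeta>) (l2_mult cnj k)) \<zeta> = rep_l2 k \<zeta>"
      using rep_l2_mult[OF id le, of "l2_mult cnj k"] rep_l2_mult[OF cnj cnj_le, of k] AE_circle_measure
      by eventually_elim (simp add: scaleC_scaleC complex_norm_square[symmetric])
  qed
qed

section \<open>The factorization theorem\<close>

text \<open>Both summands of the model space are closed subspaces, since by minimality their direct
  sum is one; the coefficient space is recovered from the constants.\<close>

lemma closed_csubspace_NF_summands:
  assumes N: "closed_csubspace (NF_space P)"
  shows "closed_csubspace (defect_adj_space P)" "closed_csubspace (closure (Delta_range P))"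
proof -
  note ND = closed_csubspaceD[OF N]
  let ?D = "defect_adj_space P" and ?L = "closure (Delta_range P)"
  have "(0, 0) \<in> NF_space P" using ND(3) by (simp add: zero_prod_def)
  then have zero: "0 \<in> h2_on ?D" "0 \<in> ?L" by (simp_all add: NF_space_def)
  have D: "\<eta> \<in> ?D \<longleftrightarrow> (h2_const \<eta>, 0) \<in> NF_space P" for \<eta>
    using zero(2) by (simp add: NF_space_def h2_const_mem_h2_on_iff)
  have L: "k \<in> ?L \<longleftrightarrow> (0, k) \<in> NF_space P" for k
    using zero(1) by (simp add: NF_space_def)
  have const0: "h2_const 0 = 0"
    using h2_const_scaleC[of 0 0] by simp
  have "csubspace ?D"
  proof (rule complex_vector.subspaceI)
    show "0 \<in> ?D" using ND(3) by (simp add: D const0 zero_prod_def)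
    show "\<eta> + \<xi> \<in> ?D" if "\<eta> \<in> ?D" "\<xi> \<in> ?D" for \<eta> \<xi>
      using ND(4)[OF that[unfolded D]] by (simp add: D h2_const_add)
    show "c *\<^sub>C \<eta> \<in> ?D" if "\<eta> \<in> ?D" for c \<eta>
      using ND(6)[OF that[unfolded D], of c] by (simp add: D h2_const_scaleC scaleC_prod_def)
  qed
  then show "closed_csubspace ?D" by (simp add: closed_csubspace_def defect_adj_space_def)
  have "csubspace ?L"
  proof (rule complex_vector.subspaceI)
    show "0 \<in> ?L" by (rule zero)
    show "k + l \<in> ?L" if "k \<in> ?L" "l \<in> ?L" for k l
      using ND(4)[OF that[unfolded L]] by (simp add: L)
    show "c *\<^sub>C k \<in> ?L" if "k \<in> ?L" for c k
      using ND(6)[OF that[unfolded L], of c] by (simp add: L scaleC_prod_def)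
  qed
  then show "closed_csubspace ?L" by (simp add: closed_csubspace_def)
qed

lemma NF_factor_unique_existence:
  assumes dS: "isometric_dilation (NF_space P) NF_shift \<rho> P"
    and min: "minimal_dilation (NF_space P) NF_shift \<rho>"
    and dV: "isometric_dilation UNIV V \<pi> P"
  shows "\<exists>!\<Phi>. NF_factor P \<rho> V \<pi> \<Phi>"
proof -
  let ?N = "NF_space P"
  note N = closed_csubspace_minimal_dilation[OF min]
  note S = isometric_dilationD[OF dS] and V = isometric_dilationD[OF dV]
  obtain \<Phi> where "\<Phi> \<in> extensional ?N" "isometry_on ?N UNIV \<Phi>" "\<And>h. \<Phi> (\<rho> h) = \<pi> h"
    "\<And>x. x \<in> ?N \<Longrightarrow> \<Phi> (adj_on ?N NF_shift x) = adj V (\<Phi> x)"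
    using dilation_factor_exists[OF dS min dV] by blast
  then have "NF_factor P \<rho> V \<pi> \<Phi>" by (auto simp: NF_factor_def)
  moreover have "\<Psi>\<^sub>1 = \<Psi>\<^sub>2" if F: "NF_factor P \<rho> V \<pi> \<Psi>\<^sub>1" "NF_factor P \<rho> V \<pi> \<Psi>\<^sub>2" for \<Psi>\<^sub>1 \<Psi>\<^sub>2
  proof (rule extensionalityI)
    show "\<Psi>\<^sub>1 \<in> extensional ?N" "\<Psi>\<^sub>2 \<in> extensional ?N" using F by (simp_all add: NF_factor_def)
    have iso: "isometry_on ?N UNIV \<Psi>\<^sub>1" "isometry_on ?N UNIV \<Psi>\<^sub>2"
      and adj: "\<And>x. x \<in> ?N \<Longrightarrow> \<Psi>\<^sub>1 (adj_on ?N NF_shift x) = adj V (\<Psi>\<^sub>1 x)"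
        "\<And>x. x \<in> ?N \<Longrightarrow> \<Psi>\<^sub>2 (adj_on ?N NF_shift x) = adj V (\<Psi>\<^sub>2 x)"
      using F by (simp_all add: NF_factor_def)
    have "\<Psi>\<^sub>1 \<circ> \<rho> = \<Psi>\<^sub>2 \<circ> \<rho>" using F unfolding NF_factor_def by metis
    then have eq: "\<Psi>\<^sub>1 (\<rho> h) = \<Psi>\<^sub>2 (\<rho> h)" for h by (metis comp_apply)
    show "\<Psi>\<^sub>1 x = \<Psi>\<^sub>2 x" if "x \<in> ?N" for x
      by (rule dilation_factor_unique[OF dS min
            iso(1) adj_intertwiner_intertwines[OF S(1) N V(1) iso(1) adj(1)]
            iso(2) adj_intertwiner_intertwines[OF S(1) N V(1) iso(2) adj(2)] eq that])
  qed
  ultimately show ?thesis by blast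
qed

text \<open>The adjoint of the model operator annihilates \<open>\<eta> \<oplus> 0\<close> for constant \<open>\<eta>\<close>. Since \<open>\<Phi>\<close>
  intertwines the adjoints, \<open>V\<^sup>*\<close> annihilates the image, which is the orthogonality that the
  decomposition of intertwiners starts from.\<close>

lemma NF_factor_decomposes:
  fixes \<omega> :: "'k::chilbert \<Rightarrow> 'e::chilbert h2 \<times> 'u::chilbert"
  assumes dS: "isometric_dilation (NF_space P) NF_shift \<rho> P"
    and min: "minimal_dilation (NF_space P) NF_shift \<rho>"
    and dV: "isometric_dilation UNIV V \<pi> P"
    and F: "NF_factor P \<rho> V \<pi> \<Phi>" and wold: "wold_decomposition V E K\<^sub>u U \<omega>"
  shows "\<exists>V\<^sub>1 V\<^sub>2. isometry_on (defect_adj_space P) E V\<^sub>1 \<and>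
    isometry_on (closure (Delta_range P)) K\<^sub>u V\<^sub>2 \<and>
    (\<forall>x\<in>NF_space P. \<omega> (\<Phi> x) = map_prod (id_tensor V\<^sub>1) V\<^sub>2 x)"
proof -
  let ?N = "NF_space P"
  note N = closed_csubspace_minimal_dilation[OF min]
  note NN = closed_csubspace_NF_summands[OF N]
  note S = isometric_dilationD[OF dS] and V = isometric_dilationD[OF dV]
  have E: "closed_csubspace E" and K\<^sub>u: "closed_csubspace K\<^sub>u" and U: "unitary_on K\<^sub>u K\<^sub>u U"
    and \<omega>: "isometry_on UNIV (h2_on E \<times> K\<^sub>u) \<omega>" "range \<omega> = h2_on E \<times> K\<^sub>u"
    and \<omega>V: "\<And>k. \<omega> (V k) = map_prod mult_z U (\<omega> k)"
    using wold by (auto simp: wold_decomposition_def unitary_on_def)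
  have \<Phi>: "isometry_on ?N UNIV \<Phi>"
    and adj: "\<And>x. x \<in> ?N \<Longrightarrow> \<Phi> (adj_on ?N NF_shift x) = adj V (\<Phi> x)"
    using F by (simp_all add: NF_factor_def)
  have inter: "\<Phi> (NF_shift x) = V (\<Phi> x)" if "x \<in> ?N" for x
    by (rule adj_intertwiner_intertwines[OF S(1) N V(1) \<Phi> adj that])
  have \<Psi>: "isometry_on (h2_on (defect_adj_space P) \<times> closure (Delta_range P)) (h2_on E \<times> K\<^sub>u) (\<omega> \<circ> \<Phi>)"
    using isometry_on_comp[OF \<Phi> \<omega>(1)] by (simp add: NF_space_def)
  have orth: "cinner (map_prod mult_z U y) ((\<omega> \<circ> \<Phi>) (h2_const \<eta>, 0)) = 0"
    if \<eta>: "\<eta> \<in> defect_adj_space P" and y: "y \<in> h2_on E \<times> K\<^sub>u" for \<eta> y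
  proof -
    let ?x = "(h2_const \<eta>, 0 :: 'a l2)"
    have x: "?x \<in> ?N"
      using \<eta> closed_csubspaceD(3)[OF NN(2)] by (simp add: NF_space_def h2_const_mem_h2_on_iff)
    have "h2_backshift (h2_const \<eta>) = 0"
      by (simp add: h2_eq_iff fun_eq_iff h2_coeff_backshift h2_coeff_const h2_coeff_zero)
    then have "adj_on ?N NF_shift ?x = 0"
      using closed_csubspaceD(1,3)[OF N]
      by (intro adj_on_eqI) (simp_all add: NF_shift_def cinner_prod_def cinner_mult_z)
    with adj[OF x] have ker: "adj V (\<Phi> ?x) = 0"
      using isometry_on_zero[OF \<Phi> closed_csubspaceD(1)[OF N]] by simp
    obtain k where k: "y = \<omega> k" using y \<omega>(2) by blast
    have "cinner (map_prod mult_z U y) (\<omega> (\<Phi> ?x)) = cinner (V k) (\<Phi> ?x)"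
      unfolding k \<omega>V[symmetric]
      by (rule isometry_on_cinner[OF \<omega>(1) complex_vector.subspace_UNIV UNIV_I UNIV_I])
    also have "\<dots> = cinner k (adj V (\<Phi> ?x))"
      by (rule adj_on_isometry(2)[OF V(1) closed_csubspace_UNIV UNIV_I])
    finally show ?thesis by (simp add: ker)
  qed
  have eit0: "mult_eit 0 = (0 :: 'a l2)"
    using isometry_on_zero[OF S(1) closed_csubspaceD(1)[OF N]]
    by (simp add: NF_shift_def zero_prod_def)
  have inter': "(\<omega> \<circ> \<Phi>) (map_prod mult_z mult_eit x) = map_prod mult_z U ((\<omega> \<circ> \<Phi>) x)"
    if "x \<in> h2_on (defect_adj_space P) \<times> closure (Delta_range P)" for x
    using inter[of x] that by (simp add: NF_space_def NF_shift_def \<omega>V)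
  obtain V\<^sub>1 V\<^sub>2 where "isometry_on (defect_adj_space P) E V\<^sub>1"
    "isometry_on (closure (Delta_range P)) K\<^sub>u V\<^sub>2"
    "\<And>x. x \<in> h2_on (defect_adj_space P) \<times> closure (Delta_range P) \<Longrightarrow>
      (\<omega> \<circ> \<Phi>) x = map_prod (id_tensor V\<^sub>1) V\<^sub>2 x"
    using shift_unitary_intertwiner_decomposes[OF NN E U K\<^sub>u \<Psi> inter' orth eit0
        mult_eit_surj_closure_Delta_range[OF NN(2)]] by blast
  then show ?thesis unfolding NF_space_def by auto
qed

theorem theorem4p1:
  fixes P :: "'h::{chilbert, second_countable_topology} \<Rightarrow> 'h"
    and \<pi>NF :: "'h \<Rightarrow> 'h h2 \<times> 'h l2"
    and V :: "'k::{chilbert, second_countable_topology} \<Rightarrow> 'k"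
    and \<pi> :: "'h \<Rightarrow> 'k"
  assumes "contraction P" and "cnu P"
    and "NF_dilation P \<pi>NF"
    and "isometric_dilation UNIV V \<pi> P"
  shows "(\<exists>!\<Phi>. NF_factor P \<pi>NF V \<pi> \<Phi>) \<and>
    (\<forall>\<Phi> (E :: 'e::{chilbert, second_countable_topology} set)
        (K\<^sub>u :: 'u::{chilbert, second_countable_topology} set) U \<omega>.
       NF_factor P \<pi>NF V \<pi> \<Phi> \<and> wold_decomposition V E K\<^sub>u U \<omega> \<longrightarrow>
       (\<exists>V\<^sub>1 V\<^sub>2. isometry_on (defect_adj_space P) E V\<^sub>1 \<and>
          isometry_on (closure (Delta_range P)) K\<^sub>u V\<^sub>2 \<and>
          (\<forall>x\<in>NF_space P. \<omega> (\<Phi> x) = map_prod (id_tensor V\<^sub>1) V\<^sub>2 x)))"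
proof -
  have dS: "isometric_dilation (NF_space P) NF_shift \<pi>NF P"
    and min: "minimal_dilation (NF_space P) NF_shift \<pi>NF"
    using assms(3) by (simp_all add: NF_dilation_def)
  show ?thesis
    using NF_factor_unique_existence[OF dS min assms(4)] NF_factor_decomposes[OF dS min assms(4)]
    by blast
qed

end
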